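(* Let $z$ be a simplicial vertex of a connected chordal graph $G$. The clique $N[z]$ is the last clique of some Prim ordering of $C(G)$ if and only if there is a sequence of edges $e_1,e_2,\dots,e_k$ of $C(G)$, where $S_i$ denotes the label of $e_i$, lying in this order on a path of $C(G)$ that ends with $N[z]$, such that (i) $S_1$ is the label of the critical edges for $N[z]$ (in $C(G)$), and $S_k$ is the set of non-simplicial vertices in $N[z]$; and (ii) for each $1\le i<k$, in the $z$-component of $C(G)-S_i$, all critical edges for $N[z]$ have the same label, and this label is $S_{i+1}$. Moreover, every clique not in the $z$-component of $C(G)-S_1$ can be the first clique of a Prim ordering of $C(G)$ ending with $N[z]$.
   Context: A vertex is simplicial if its closed neighborhood is a clique. A graph is chordal if it has no induced cycle on four or more vertices. The weighted clique graph $C(G)$ has the maximal cliques of $G$ as vertices; $K_i,K_j$ are adjacent iff $K_i\cap K_j$ is a minimal $x$-$y$ separator (inclusion-minimal vertex set not containing $x,y$ separating them) for all $x\in K_i\setminus K_j$, $y\in K_j\setminus K_i$; the edge has label $K_i\cap K_j$ and weight $|K_i\cap K_j|$. For $S\subseteq V(G)$, $C(G)-S$ is obtained from $C(G)$ by deleting all edges whose labels are subsets of $S$; the $z$-component is its connected component containing $N[z]$. For a connected edge-weighted subgraph $H$ of $C(G)$ containing a clique $K$, an edge $e$ of $H$ is a critical edge for $K$ (in $H$) if $e$ has minimum weight among edges of $H$ and one end of $e$ lies in the same component as $K$ after deleting from $H$ all its minimum-weight edges. A Prim ordering of $C(G)$ is an order in which Prim's maximum-spanning-tree algorithm includes the cliques: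 start from an arbitrary clique and repeatedly include a new clique via an edge of maximum weight among edges between included and non-included cliques (ties arbitrary).
   Formalization: The formal theorem additionally assumes that G is not complete: for complete G, C(G) is a single vertex without edges, so N[z] is trivially last in the only Prim ordering while no edge e_1 exists and S_1 is undefined. *)

theory Defs
  imports "Graph_Theory.Graph_Theory" "HOL-Library.Sublist"
begin

text \<open>
  Finite simple graphs are rendered by the locale \<open>pair_graph\<close>: finite, loop-free, symmetric
  digraphs whose arcs are vertex pairs. An undirected edge is thus a pair of opposite arcs.
\<close>

definition closed_nbhd :: "'a pair_pre_digraph \<Rightarrow> 'a \<Rightarrow> 'a set" where
  "closed_nbhd G v = insert v {u. v \<rightarrow>\<^bsub>G\<^esub> u}"

definition is_clique :: "'a pair_pre_digraph \<Rightarrow> 'a set \<Rightarrow> bool" where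
  "is_clique G K \<longleftrightarrow> K \<subseteq> pverts G \<and> (\<forall>u\<in>K. \<forall>v\<in>K. u \<noteq> v \<longrightarrow> u \<rightarrow>\<^bsub>G\<^esub> v)"

definition maximal_clique :: "'a pair_pre_digraph \<Rightarrow> 'a set \<Rightarrow> bool" where
  "maximal_clique G K \<longleftrightarrow> is_clique G K \<and> (\<forall>L. is_clique G L \<and> K \<subseteq> L \<longrightarrow> L = K)"

definition simplicial :: "'a pair_pre_digraph \<Rightarrow> 'a \<Rightarrow> bool" where
  "simplicial G v \<longleftrightarrow> v \<in> pverts G \<and> is_clique G (closed_nbhd G v)"

text \<open>
  In a symmetric digraph \<open>u, v, u\<close> also counts as a library cycle, but a cycle with at least three
  arcs visits pairwise distinct vertices and is an undirected cycle. It is induced if the only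
  arcs between its vertices are its own arcs and their reversals.
\<close>

definition induced_cycle :: "'a pair_pre_digraph \<Rightarrow> ('a \<times> 'a) list \<Rightarrow> bool" where
  "induced_cycle G p \<longleftrightarrow>
     pre_digraph.cycle G p \<and> arcs (G \<restriction> (fst ` set p)) = set p \<union> (set p)\<inverse>"

definition chordal :: "'a pair_pre_digraph \<Rightarrow> bool" where
  "chordal G \<longleftrightarrow> \<not> (\<exists>p. induced_cycle G p \<and> length p \<ge> 4)"

definition separator :: "'a pair_pre_digraph \<Rightarrow> 'a \<Rightarrow> 'a \<Rightarrow> 'a set \<Rightarrow> bool" where
  "separator G x y S \<longleftrightarrow> S \<subseteq> pverts G \<and> x \<in> pverts G - S \<and> y \<in> pverts G - S \<and>
     \<not> x \<rightarrow>\<^sup>*\<^bsub>G \<restriction> (pverts G - S)\<^esub> y"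

definition minimal_separator :: "'a pair_pre_digraph \<Rightarrow> 'a \<Rightarrow> 'a \<Rightarrow> 'a set \<Rightarrow> bool" where
  "minimal_separator G x y S \<longleftrightarrow> separator G x y S \<and> (\<forall>T. T \<subset> S \<longrightarrow> \<not> separator G x y T)"

text \<open>
  The condition \<open>K \<noteq> L\<close> excludes loops, for which the requirement on \<open>x\<close> and \<open>y\<close> is vacuous.
\<close>

definition clique_graph :: "'a pair_pre_digraph \<Rightarrow> 'a set pair_pre_digraph" where
  "clique_graph G = \<lparr>
     pverts = {K. maximal_clique G K},
     parcs = {(K, L). maximal_clique G K \<and> maximal_clique G L \<and> K \<noteq> L \<and>
                (\<forall>x\<in>K - L. \<forall>y\<in>L - K. minimal_separator G x y (K \<inter> L))} \<rparr>"

definition edge_label :: "'a set \<times> 'a set \<Rightarrow> 'a set" where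
  "edge_label e = fst e \<inter> snd e"

definition edge_weight :: "'a set \<times> 'a set \<Rightarrow> nat" where
  "edge_weight e = card (edge_label e)"

text \<open>
  Subgraphs of the clique graph have type \<open>('a set, 'a set \<times> 'a set) pre_digraph\<close>. They are
  symmetric, hence their strongly connected components are their connected components.
\<close>

definition component ::
    "('a set, 'a set \<times> 'a set) pre_digraph \<Rightarrow> 'a set \<Rightarrow> ('a set, 'a set \<times> 'a set) pre_digraph"
  where "component H K = H \<restriction> pre_digraph.scc_of H K"

definition del_arcs ::
    "('a set, 'a set \<times> 'a set) pre_digraph \<Rightarrow> ('a set \<times> 'a set) set \<Rightarrow>
     ('a set, 'a set \<times> 'a set) pre_digraph"
  where "del_arcs H F = H\<lparr>arcs := arcs H - F\<rparr>"

definition z_component ::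
    "'a pair_pre_digraph \<Rightarrow> 'a \<Rightarrow> 'a set \<Rightarrow> ('a set, 'a set \<times> 'a set) pre_digraph"
  where "z_component G z S =
     component (del_arcs (clique_graph G) {e. edge_label e \<subseteq> S}) (closed_nbhd G z)"

definition min_weight_edges ::
    "('a set, 'a set \<times> 'a set) pre_digraph \<Rightarrow> ('a set \<times> 'a set) set"
  where "min_weight_edges H = {e \<in> arcs H. \<forall>f\<in>arcs H. edge_weight e \<le> edge_weight f}"

definition critical_edges ::
    "('a set, 'a set \<times> 'a set) pre_digraph \<Rightarrow> 'a set \<Rightarrow> ('a set \<times> 'a set) set"
  where "critical_edges H K = {e \<in> min_weight_edges H.
     \<exists>L\<in>{fst e, snd e}. L \<in> verts (component (del_arcs H (min_weight_edges H)) K)}"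

definition cut_edges ::
    "('a set, 'a set \<times> 'a set) pre_digraph \<Rightarrow> 'a set set \<Rightarrow> ('a set \<times> 'a set) set"
  where "cut_edges H A = {e \<in> arcs H. fst e \<in> A \<and> snd e \<notin> A}"

definition prim_ordering ::
    "('a set, 'a set \<times> 'a set) pre_digraph \<Rightarrow> 'a set list \<Rightarrow> bool"
  where "prim_ordering H Ks \<longleftrightarrow> distinct Ks \<and> set Ks = verts H \<and>
     (\<forall>i. 0 < i \<and> i < length Ks \<longrightarrow>
        (\<exists>e\<in>cut_edges H (set (take i Ks)). snd e = Ks ! i \<and>
           (\<forall>f\<in>cut_edges H (set (take i Ks)). edge_weight f \<le> edge_weight e)))"

text \<open>
  The list \<open>es\<close> is \<open>e\<^sub>1, \<dots>, e\<^sub>k\<close> with \<open>k \<ge> 1\<close>, each edge being represented by the arc that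
  points along the path towards \<open>N[z]\<close>. Equating a set of labels with a singleton says that
  critical edges exist and that all of them carry this label.
\<close>

definition critical_sequence :: "'a pair_pre_digraph \<Rightarrow> 'a \<Rightarrow> ('a set \<times> 'a set) list \<Rightarrow> bool" where
  "critical_sequence G z es \<longleftrightarrow>
     es \<noteq> [] \<and>
     (\<exists>K p. pre_digraph.apath (clique_graph G) K p (closed_nbhd G z) \<and> subseq es p) \<and>
     edge_label ` critical_edges (clique_graph G) (closed_nbhd G z) = {edge_label (hd es)} \<and>
     edge_label (last es) = {v \<in> closed_nbhd G z. \<not> simplicial G v} \<and>
     (\<forall>i. Suc i < length es \<longrightarrow>
        edge_label ` critical_edges (z_component G z (edge_label (es ! i))) (closed_nbhd G z) =
          {edge_label (es ! Suc i)})"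

end

theory Submission
  imports Defs
begin

text \<open>
  Let \<open>Z = N[z]\<close> and let \<open>Q s\<close> be the component of \<open>Z\<close> in the clique graph restricted to the edges of
  weight at least \<open>s\<close>; these sets decrease from all cliques to \<open>{Z}\<close>. Two properties of the clique
  graph suffice: an edge with label \<open>S\<close> joins different components of the graph without the edges
  whose label lies in \<open>S\<close>, and any two cliques \<open>A\<close>, \<open>B\<close> are adjacent or joined by a path all of whose
  labels properly contain \<open>A \<inter> B\<close> (this uses chordality). No clique trees are needed.

  Prim's algorithm exhausts a component of heavy edges before it leaves it, so in an ordering that
  ends with \<open>Z\<close> every \<open>Q s\<close> is a final segment. Both sides of the theorem turn out to be equivalent to
  the following: whenever \<open>Q (t + 1) \<noteq> Q t\<close>, some edge from \<open>Q t\<close> into \<open>Q (t + 1)\<close> has a label that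
  contains the label of every edge entering \<open>Q (t + 1)\<close>. These labels form the critical sequence.
\<close>

text \<open>Edges entering \<open>Q (Suc t)\<close> come from the layer
  \<open>Q t - Q (Suc t)\<close>, where they weigh exactly \<open>t\<close>, or from farther out,
  where they are lighter. Requiring containment of the lighter labels too makes deletion of the
  labels inside the level label isolate exactly \<open>Q (Suc t)\<close>, so that thresholds and
  z-components can be exchanged. The lighter edges are the obstacle in both directions. For Prim
  orderings, an induction from heavy to light replaces a light crossing edge by a heavier one. For
  critical sequences, a lighter label that is not contained would make the next critical label
  repeat an earlier one; as each label determines its successor, the sequence would cycle, whereas
  its last label isolates \<open>Z\<close> and admits no successor. Conversely, levels yield an
  ordering and a path only if each entry into \<open>Q (Suc t)\<close> ends outside the next smaller
  component; otherwise a layer would be skipped. Such an entry is obtained by exchanging an endpoint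
  of the entry edge.\<close>

lemma rtrancl_subsetD: "\<lbrakk>(a, b) \<in> r\<^sup>*; r \<subseteq> s\<rbrakk> \<Longrightarrow> (a, b) \<in> s\<^sup>*"
  using rtrancl_mono by blast

text \<open>Recording the first exit keeps the part before it inside \<open>C\<close>. The induction
  carries a second statement, for endpoints in \<open>C\<close>: the path either stays in
  \<open>C\<close> throughout or has already left it.\<close>

lemma rtrancl_exit:
  assumes "(a, b) \<in> r\<^sup>*" "a \<in> C" "b \<notin> C"
  obtains x y where "(x, y) \<in> r" "(a, x) \<in> (r \<inter> C \<times> C)\<^sup>*" "x \<in> C" "y \<notin> C" "(y, b) \<in> r\<^sup>*"
proof -
  have "b \<notin> C \<longrightarrow> (\<exists>x y. (x, y) \<in> r \<and> (a, x) \<in> (r \<inter> C \<times> C)\<^sup>* \<and> x \<in> C \<and> y \<notin> C \<and> (y, b) \<in> r\<^sup>*)"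
    and "b \<in> C \<longrightarrow> (a, b) \<in> (r \<inter> C \<times> C)\<^sup>* \<or>
      (\<exists>x y. (x, y) \<in> r \<and> (a, x) \<in> (r \<inter> C \<times> C)\<^sup>* \<and> x \<in> C \<and> y \<notin> C \<and> (y, b) \<in> r\<^sup>*)"
    using assms(1)
  proof (induction rule: rtrancl_induct)
    case base
    { case 1 show ?case using assms(2) by blast }
    { case 2 show ?case by blast }
  next
    case (step y w)
    { case 1
      show ?case
      proof
        assume "w \<notin> C"
        then show "\<exists>x y. (x, y) \<in> r \<and> (a, x) \<in> (r \<inter> C \<times> C)\<^sup>* \<and> x \<in> C \<and> y \<notin> C \<and> (y, w) \<in> r\<^sup>*"
          using step by (cases "y \<in> C") (blast intro: rtrancl_into_rtrancl)+
      qed }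
    { case 2
      show ?case
      proof
        assume "w \<in> C"
        show "(a, w) \<in> (r \<inter> C \<times> C)\<^sup>* \<or>
          (\<exists>x y. (x, y) \<in> r \<and> (a, x) \<in> (r \<inter> C \<times> C)\<^sup>* \<and> x \<in> C \<and> y \<notin> C \<and> (y, w) \<in> r\<^sup>*)"
        proof (cases "y \<in> C \<and> (a, y) \<in> (r \<inter> C \<times> C)\<^sup>*")
          case True
          then have "(y, w) \<in> r \<inter> C \<times> C" using step \<open>w \<in> C\<close> by blast
          then show ?thesis using True by (blast intro: rtrancl_into_rtrancl)
        next
          case False
          then show ?thesis using step by (blast intro: rtrancl_into_rtrancl)
        qed
      qed }
  qed
  then show thesis using assms(3) that by blast
qed

lemma rtrancl_exit_edge:
  assumes "(a, b) \<in> r\<^sup>*" "a \<in> C" "b \<notin> C"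
  obtains x y where "(x, y) \<in> r" "x \<in> C" "y \<notin> C"
  using rtrancl_exit[OF assms] by metis

lemma in_set_take_iff: "distinct Ks \<Longrightarrow> i < length Ks \<Longrightarrow> Ks ! i \<in> set (take n Ks) \<longleftrightarrow> i < n"
  by (auto simp: in_set_conv_nth nth_eq_iff_index_eq)

section \<open>Components of graphs with a symmetric arc set\<close>

abbreviation arc_graph :: "'a set \<Rightarrow> ('a \<times> 'a) set \<Rightarrow> ('a, 'a \<times> 'a) pre_digraph" where
  "arc_graph W F \<equiv> \<lparr>verts = W, arcs = F, tail = fst, head = snd\<rparr>"

lemma scc_of_arc_graph:
  assumes "K \<in> W" "F \<subseteq> W \<times> W" "sym F"
  shows "pre_digraph.scc_of (arc_graph W F) K = {L. (K, L) \<in> F\<^sup>*}"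
proof -
  interpret wf_digraph "arc_graph W F" using assms by unfold_locales auto
  have ends: "arcs_ends (arc_graph W F) = F" by (simp add: arcs_ends_conv)
  have "(L, K) \<in> F\<^sup>*" if "(K, L) \<in> F\<^sup>*" for L
    using that sym_rtrancl[OF assms(3)] by (rule symD[rotated])
  moreover have "L \<in> W" if "(K, L) \<in> F\<^sup>*" for L
    using that assms(1,2) by (induction rule: rtrancl_induct) auto
  ultimately show ?thesis
    unfolding scc_of_def using assms(1) by (auto simp: reachable_conv ends)
qed

lemma component_arc_graph:
  assumes "K \<in> W" "F \<subseteq> W \<times> W" "sym F"
  shows "component (arc_graph W F) K =
    arc_graph {L. (K, L) \<in> F\<^sup>*} (F \<inter> {L. (K, L) \<in> F\<^sup>*} \<times> {L. (K, L) \<in> F\<^sup>*})"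
  unfolding component_def scc_of_arc_graph[OF assms] induce_subgraph_def by auto

lemma edge_label_Pair [simp]: "edge_label (A, B) = A \<inter> B"
  by (simp add: edge_label_def)

lemma sym_edge_label_le: "sym F \<Longrightarrow> sym (F - {e. edge_label e \<subseteq> S})"
  by (auto simp: sym_def Int_commute)

section \<open>Prim orderings in a weighted clique graph\<close>

text \<open>\<open>V\<close> stands for the maximal cliques, \<open>E\<close> for their adjacency
  and \<open>Z\<close> for N[z]. Since the empty path joins a clique to itself, the last assumption
  also rules out loops.\<close>

locale label_graph =
  fixes V :: "'a set set" and E :: "('a set \<times> 'a set) set" and Z :: "'a set"
  assumes finite_V: "finite V"
    and finite_members: "A \<in> V \<Longrightarrow> finite A"
    and E_subset: "E \<subseteq> V \<times> V"
    and sym_E: "sym E"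
    and Z_in_V: "Z \<in> V"
    and edge_or_path: "\<lbrakk>A \<in> V; B \<in> V; A \<noteq> B\<rbrakk> \<Longrightarrow>
      (A, B) \<in> E \<or> (A, B) \<in> {(X, Y) \<in> E. A \<inter> B \<subset> X \<inter> Y}\<^sup>*"
    and edge_separates: "(A, B) \<in> E \<Longrightarrow> (A, B) \<notin> {(X, Y) \<in> E. \<not> X \<inter> Y \<subseteq> A \<inter> B}\<^sup>*"
begin

section \<open>Components of \<open>Z\<close> above a weight threshold\<close>

definition upper :: "nat \<Rightarrow> ('a set \<times> 'a set) set" where
  "upper s = {(A, B) \<in> E. s \<le> card (A \<inter> B)}"

definition Q :: "nat \<Rightarrow> 'a set set" where
  "Q s = {X. (Z, X) \<in> (upper s)\<^sup>*}"

lemma E_D: "(A, B) \<in> E \<Longrightarrow> A \<in> V" "(A, B) \<in> E \<Longrightarrow> B \<in> V"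
  using E_subset by blast+

lemma E_symD: "(A, B) \<in> E \<Longrightarrow> (B, A) \<in> E"
  using sym_E by (rule symD)

lemma upper_symD: "(A, B) \<in> upper s \<Longrightarrow> (B, A) \<in> upper s"
  using E_symD[of A B] by (simp add: upper_def Int_commute)

lemma upper_rtrancl_symD: "(A, B) \<in> (upper s)\<^sup>* \<Longrightarrow> (B, A) \<in> (upper s)\<^sup>*"
  by (rule symD[OF sym_rtrancl[OF symI]]) (rule upper_symD)

lemma upper_antimono: "s \<le> t \<Longrightarrow> upper t \<subseteq> upper s"
  by (auto simp: upper_def)

lemma Q_antimono: "s \<le> t \<Longrightarrow> Q t \<subseteq> Q s"
  unfolding Q_def using rtrancl_mono[OF upper_antimono] by blast

lemma Z_in_Q: "Z \<in> Q s"
  by (simp add: Q_def)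

lemma Q_subset_V: "Q s \<subseteq> V"
proof
  fix X assume "X \<in> Q s"
  then have "(Z, X) \<in> (upper s)\<^sup>*" by (simp add: Q_def)
  then show "X \<in> V"
    by (induction rule: rtrancl_induct) (auto simp: Z_in_V upper_def dest: E_D)
qed

lemma finite_Q: "finite (Q s)"
  using Q_subset_V finite_V by (rule finite_subset)

lemma Q_upper_rtrancl: "\<lbrakk>X \<in> Q s; (X, Y) \<in> (upper s)\<^sup>*\<rbrakk> \<Longrightarrow> Y \<in> Q s"
  by (simp add: Q_def)

lemma Q_closed: "\<lbrakk>X \<in> Q s; (X, Y) \<in> E; s \<le> card (X \<inter> Y)\<rbrakk> \<Longrightarrow> Y \<in> Q s"
  by (rule Q_upper_rtrancl) (auto simp: upper_def)

lemma Q_closed': "\<lbrakk>Y \<in> Q s; (X, Y) \<in> E; s \<le> card (X \<inter> Y)\<rbrakk> \<Longrightarrow> X \<in> Q s"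
  using Q_closed[of Y s X] E_symD[of X Y] by (simp add: Int_commute)

lemma Q_upper_path: "\<lbrakk>X \<in> Q s; Y \<in> Q s\<rbrakk> \<Longrightarrow> (X, Y) \<in> (upper s)\<^sup>*"
  unfolding Q_def by (rule rtrancl_trans[of X Z]) (simp_all add: upper_rtrancl_symD)

text \<open>Bridge from weights to labels: a label with more than \<open>card R\<close> elements
  cannot fit into \<open>R\<close>.\<close>

lemma upper_avoids:
  assumes "finite R" "card R < s"
  shows "upper s \<subseteq> {(X, Y) \<in> E. \<not> X \<inter> Y \<subseteq> R}"
proof (rule subsetI)
  fix e assume "e \<in> upper s"
  then obtain X Y where e: "e = (X, Y)" "(X, Y) \<in> E" "s \<le> card (X \<inter> Y)"
    by (auto simp: upper_def)
  then have "\<not> X \<inter> Y \<subseteq> R" using card_mono[OF assms(1)] assms(2) by (meson leD le_trans)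
  then show "e \<in> {(X, Y) \<in> E. \<not> X \<inter> Y \<subseteq> R}" using e by blast
qed

lemma finite_label: "(A, B) \<in> E \<Longrightarrow> finite (A \<inter> B)"
  using E_D finite_members by blast

text \<open>The ends of a lighter edge inside \<open>Q s\<close> would also be joined by edges of
  weight at least \<open>s\<close>, none of whose labels fits into that of the light edge, against
  \<open>edge_separates\<close>.\<close>

lemma inner_weight:
  assumes "A \<in> Q s" "B \<in> Q s" "(A, B) \<in> E"
  shows "s \<le> card (A \<inter> B)"
proof (rule ccontr)
  assume "\<not> s \<le> card (A \<inter> B)"
  then have "upper s \<subseteq> {(X, Y) \<in> E. \<not> X \<inter> Y \<subseteq> A \<inter> B}"
    using upper_avoids finite_label assms(3) by (meson not_le)
  then have "(A, B) \<in> {(X, Y) \<in> E. \<not> X \<inter> Y \<subseteq> A \<inter> B}\<^sup>*"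
    by (rule rtrancl_subsetD[OF Q_upper_path[OF assms(1,2)]])
  then show False using edge_separates[OF assms(3)] by simp
qed

lemma supset_path_upper:
  assumes "(A, B) \<in> {(X, Y) \<in> E. R \<subset> X \<inter> Y}\<^sup>*"
  shows "(A, B) \<in> (upper (Suc (card R)))\<^sup>*"
proof -
  have "{(X, Y) \<in> E. R \<subset> X \<inter> Y} \<subseteq> upper (Suc (card R))"
  proof (rule subsetI)
    fix e assume "e \<in> {(X, Y) \<in> E. R \<subset> X \<inter> Y}"
    then obtain X Y where e: "e = (X, Y)" "(X, Y) \<in> E" "R \<subset> X \<inter> Y" by blast
    then show "e \<in> upper (Suc (card R))"
      using psubset_card_mono[OF finite_label[OF e(2)] e(3)] by (simp add: upper_def)
  qed
  then show ?thesis by (rule rtrancl_subsetD[OF assms])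
qed

text \<open>If \<open>A\<close> and \<open>B\<close> are distinct and not adjacent, the labels on
  the path from \<open>edge_or_path\<close> properly contain \<open>A \<inter> B\<close>, hence
  \<open>R\<close>, and so have more than \<open>card R\<close> elements.\<close>

lemma supsets_edge_or_path:
  assumes "A \<in> V" "B \<in> V" "R \<subseteq> A" "R \<subseteq> B"
  shows "(A, B) \<in> E \<or> (A, B) \<in> (upper (Suc (card R)))\<^sup>*"
proof (cases "A = B \<or> (A, B) \<in> E")
  case False
  then have "(A, B) \<in> {(X, Y) \<in> E. A \<inter> B \<subset> X \<inter> Y}\<^sup>*"
    using edge_or_path[OF assms(1,2)] by blast
  moreover have "{(X, Y) \<in> E. A \<inter> B \<subset> X \<inter> Y} \<subseteq> {(X, Y) \<in> E. R \<subset> X \<inter> Y}"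
    using assms(3,4) by blast
  ultimately have "(A, B) \<in> {(X, Y) \<in> E. R \<subset> X \<inter> Y}\<^sup>*" by (rule rtrancl_subsetD)
  then show ?thesis using supset_path_upper by simp
next
  case True
  then show ?thesis
  proof
    assume "A = B"
    then show ?thesis by simp
  next
    assume "(A, B) \<in> E"
    then show ?thesis ..
  qed
qed

text \<open>Upgrades a path that merely avoids subsets of \<open>R\<close> to one of proper
  supersets. If \<open>A\<close> and \<open>B\<close> are adjacent, their label contains
  \<open>R\<close> and cannot equal it, since the given path would violate
  \<open>edge_separates\<close>; otherwise \<open>edge_or_path\<close> applies.\<close>

lemma supset_path:
  assumes "A \<in> V" "B \<in> V" "R \<subseteq> A" "R \<subseteq> B"
    and "(A, B) \<in> {(X, Y) \<in> E. \<not> X \<inter> Y \<subseteq> R}\<^sup>*"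
  shows "(A, B) \<in> {(X, Y) \<in> E. R \<subset> X \<inter> Y}\<^sup>*"
proof (cases "A = B \<or> (A, B) \<in> E")
  case True
  then show ?thesis
  proof
    assume AB: "(A, B) \<in> E"
    then have "R \<noteq> A \<inter> B" using edge_separates[OF AB] assms(5) by (cases "R = A \<inter> B") simp_all
    then have "(A, B) \<in> {(X, Y) \<in> E. R \<subset> X \<inter> Y}" using AB assms(3,4) by blast
    then show ?thesis by (rule r_into_rtrancl)
  qed simp
next
  case False
  then have "(A, B) \<in> {(X, Y) \<in> E. A \<inter> B \<subset> X \<inter> Y}\<^sup>*"
    using edge_or_path[OF assms(1,2)] by blast
  moreover have "{(X, Y) \<in> E. A \<inter> B \<subset> X \<inter> Y} \<subseteq> {(X, Y) \<in> E. R \<subset> X \<inter> Y}"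
    using assms(3,4) by blast
  ultimately show ?thesis by (rule rtrancl_subsetD)
qed

text \<open>Substitute for the junction property of clique trees: the common vertices of two cliques
  persist along some path between them. In particular, the graph is connected.\<close>

lemma path_superset_labels:
  assumes "A \<in> V" "B \<in> V"
  shows "(A, B) \<in> {(X, Y) \<in> E. A \<inter> B \<subseteq> X \<inter> Y}\<^sup>*"
proof (cases "A = B \<or> (A, B) \<in> E")
  case False
  then have "(A, B) \<in> {(X, Y) \<in> E. A \<inter> B \<subset> X \<inter> Y}\<^sup>*"
    using edge_or_path[OF assms(1,2)] by blast
  moreover have "{(X, Y) \<in> E. A \<inter> B \<subset> X \<inter> Y} \<subseteq> {(X, Y) \<in> E. A \<inter> B \<subseteq> X \<inter> Y}"
    by blast
  ultimately show ?thesis by (rule rtrancl_subsetD)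
next
  case True
  then show ?thesis
  proof
    assume "(A, B) \<in> E"
    then have "(A, B) \<in> {(X, Y) \<in> E. A \<inter> B \<subseteq> X \<inter> Y}" by blast
    then show ?thesis by (rule r_into_rtrancl)
  qed simp
qed

lemma Q_0: "Q 0 = V"
proof
  show "V \<subseteq> Q 0"
  proof
    fix X assume "X \<in> V"
    then have "(Z, X) \<in> {(A, B) \<in> E. Z \<inter> X \<subseteq> A \<inter> B}\<^sup>*"
      by (rule path_superset_labels[OF Z_in_V])
    moreover have "{(A, B) \<in> E. Z \<inter> X \<subseteq> A \<inter> B} \<subseteq> upper 0" by (auto simp: upper_def)
    ultimately have "(Z, X) \<in> (upper 0)\<^sup>*" by (rule rtrancl_subsetD)
    then show "X \<in> Q 0" by (simp add: Q_def)
  qed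
qed (rule Q_subset_V)

lemma Q_large: "\<exists>s. Q s = {Z}"
proof
  let ?s = "Suc (card (\<Union>V))"
  have "upper ?s = {}"
  proof -
    have "card (A \<inter> B) \<le> card (\<Union>V)" if "(A, B) \<in> E" for A B
      using E_D[OF that] by (intro card_mono) (auto intro: finite_V finite_members)
    then show ?thesis by (fastforce simp: upper_def)
  qed
  then show "Q ?s = {Z}" by (simp add: Q_def)
qed

section \<open>Jumps and level labels\<close>

definition jump :: "nat \<Rightarrow> bool" where
  "jump t \<longleftrightarrow> Q (Suc t) \<noteq> Q t"

lemma Q_Suc_subset: "Q (Suc t) \<subseteq> Q t"
  by (simp add: Q_antimono)

lemma Q_eq_no_jump: "\<lbrakk>s \<le> t; \<And>u. \<lbrakk>s \<le> u; u < t\<rbrakk> \<Longrightarrow> \<not> jump u\<rbrakk> \<Longrightarrow> Q t = Q s"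
proof (induction t)
  case (Suc t)
  then show ?case by (cases "s = Suc t") (auto simp: jump_def)
qed simp

text \<open>Skips the thresholds at which nothing changes; a jump must follow because
  \<open>Q\<close> eventually shrinks to \<open>{Z}\<close>.\<close>

lemma next_jump:
  assumes "Q s \<noteq> {Z}"
  obtains t where "s \<le> t" "jump t" "Q t = Q s" "\<And>u. \<lbrakk>s \<le> u; u < t\<rbrakk> \<Longrightarrow> \<not> jump u"
proof -
  obtain m where m: "Q m = {Z}" using Q_large by blast
  have "Z \<in> Q s" by (rule Z_in_Q)
  then have "\<not> m \<le> s" using Q_antimono[of m s] m assms by blast
  then have ex: "\<exists>t. s \<le> t \<and> jump t" using Q_eq_no_jump[of s m] m assms by (metis nat_le_linear)
  define t where "t = (LEAST t. s \<le> t \<and> jump t)"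
  have t: "s \<le> t \<and> jump t" unfolding t_def using ex by (rule LeastI_ex)
  have no: "\<not> jump u" if "s \<le> u" "u < t" for u
    using not_less_Least[of u "\<lambda>t. s \<le> t \<and> jump t"] that t_def by blast
  show thesis using that[of t] t no Q_eq_no_jump[of s t] by blast
qed

lemma jump_crossing:
  assumes "jump t"
  obtains X Y where "(X, Y) \<in> E" "X \<in> Q t - Q (Suc t)" "Y \<in> Q (Suc t)" "t \<le> card (X \<inter> Y)"
proof -
  obtain W where W: "W \<in> Q t" "W \<notin> Q (Suc t)"
    using assms Q_Suc_subset by (auto simp: jump_def)
  have "(Z, W) \<in> (upper t)\<^sup>*" using W by (simp add: Q_def)
  then obtain X Y where XY: "(X, Y) \<in> upper t" "X \<in> Q (Suc t)" "Y \<notin> Q (Suc t)"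
    using rtrancl_exit[OF _ Z_in_Q W(2)] by metis
  have "Y \<in> Q t"
    using XY Q_Suc_subset Q_upper_rtrancl by blast
  then show thesis using XY that[of Y X] upper_symD[OF XY(1)] by (auto simp: upper_def)
qed

lemma crossing_weight_less:
  assumes "(X, Y) \<in> E" "X \<notin> Q s" "Y \<in> Q s"
  shows "card (X \<inter> Y) < s"
  using Q_closed'[OF assms(3,1)] assms(2) by (meson not_le)

text \<open>The second clause ranges over all cliques outside \<open>Q (Suc t)\<close>, also those
  outside \<open>Q t\<close>; therefore deleting the labels inside \<open>S\<close> cuts off
  \<open>Q (Suc t)\<close> entirely.\<close>

definition lev :: "nat \<Rightarrow> 'a set \<Rightarrow> bool" where
  "lev t S \<longleftrightarrow>
    (\<exists>X Y. (X, Y) \<in> E \<and> X \<in> Q t - Q (Suc t) \<and> Y \<in> Q (Suc t) \<and> X \<inter> Y = S) \<and>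
    (\<forall>X Y. (X, Y) \<in> E \<longrightarrow> X \<notin> Q (Suc t) \<longrightarrow> Y \<in> Q (Suc t) \<longrightarrow> X \<inter> Y \<subseteq> S)"

text \<open>A heavier edge would draw \<open>X\<close> into \<open>Q (Suc t)\<close>, and a lighter
  one cannot have both ends in \<open>Q t\<close>.\<close>

lemma crossing_weight:
  assumes "(X, Y) \<in> E" "X \<in> Q t - Q (Suc t)" "Y \<in> Q (Suc t)"
  shows "card (X \<inter> Y) = t"
proof -
  have "card (X \<inter> Y) < Suc t" using assms by (intro crossing_weight_less) auto
  moreover have "t \<le> card (X \<inter> Y)" using assms Q_Suc_subset by (intro inner_weight) auto
  ultimately show ?thesis by simp
qed

lemma lev_jump: "lev t S \<Longrightarrow> jump t"
  by (auto simp: lev_def jump_def)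

lemma lev_card: "lev t S \<Longrightarrow> card S = t"
  by (auto simp: lev_def crossing_weight)

lemma lev_finite: "lev t S \<Longrightarrow> finite S"
  by (auto simp: lev_def finite_label)

lemma lev_crossing_subset: "\<lbrakk>lev t S; (X, Y) \<in> E; X \<notin> Q (Suc t); Y \<in> Q (Suc t)\<rbrakk> \<Longrightarrow> X \<inter> Y \<subseteq> S"
  by (auto simp: lev_def)

lemma lev_crossing:
  assumes "lev t S" "(X, Y) \<in> E" "X \<in> Q t - Q (Suc t)" "Y \<in> Q (Suc t)"
  shows "X \<inter> Y = S"
  using lev_crossing_subset[OF assms(1,2)] crossing_weight[OF assms(2-4)] assms(3,4)
    lev_card[OF assms(1)] lev_finite[OF assms(1)] by (intro card_subset_eq) auto

subsection \<open>From Prim orderings to levels\<close>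

text \<open>Relative to a set \<open>W\<close>, ignoring edges that leave it, so that orderings of
  layers can be built separately and concatenated.\<close>

definition prim :: "'a set set \<Rightarrow> 'a set list \<Rightarrow> bool" where
  "prim W Ks \<longleftrightarrow> distinct Ks \<and> set Ks = W \<and>
    (\<forall>i. 0 < i \<and> i < length Ks \<longrightarrow>
      (\<exists>A\<in>set (take i Ks). (A, Ks ! i) \<in> E \<and>
        (\<forall>X\<in>set (take i Ks). \<forall>Y\<in>W - set (take i Ks).
          (X, Y) \<in> E \<longrightarrow> card (X \<inter> Y) \<le> card (A \<inter> Ks ! i))))"

text \<open>The given path leaves the included cliques along an edge of weight at least
  \<open>s\<close>; the maximal edge chosen by Prim's algorithm is no lighter.\<close>

lemma prim_parent:
  assumes "prim V Ks" "0 < i" "i < length Ks"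
    and "X \<in> set (take i Ks)" "Y \<in> V" "Y \<notin> set (take i Ks)" "(X, Y) \<in> (upper s)\<^sup>*"
  obtains j where "j < i" "(Ks ! j, Ks ! i) \<in> upper s"
proof -
  have "\<exists>A\<in>set (take i Ks). (A, Ks ! i) \<in> E \<and>
        (\<forall>X\<in>set (take i Ks). \<forall>Y\<in>V - set (take i Ks).
          (X, Y) \<in> E \<longrightarrow> card (X \<inter> Y) \<le> card (A \<inter> Ks ! i))"
    using assms(1-3) by (simp add: prim_def)
  then obtain A where A: "A \<in> set (take i Ks)" "(A, Ks ! i) \<in> E"
    and A_max: "\<forall>X\<in>set (take i Ks). \<forall>Y\<in>V - set (take i Ks).
      (X, Y) \<in> E \<longrightarrow> card (X \<inter> Y) \<le> card (A \<inter> Ks ! i)"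
    by blast
  obtain P P' where PP: "(P, P') \<in> upper s" "P \<in> set (take i Ks)" "P' \<notin> set (take i Ks)"
    using rtrancl_exit[OF assms(7,4,6)] by metis
  have PE: "(P, P') \<in> E" "s \<le> card (P \<inter> P')" using PP(1) by (auto simp: upper_def)
  have "card (P \<inter> P') \<le> card (A \<inter> Ks ! i)"
    using A_max PP(2,3) PE(1) E_D(2)[OF PE(1)] by simp
  then have "(A, Ks ! i) \<in> upper s" using A PE by (simp add: upper_def)
  moreover obtain j where "j < i" "A = Ks ! j"
    using A(1) assms(3) by (auto simp: in_set_conv_nth)
  ultimately show thesis using that by simp
qed

text \<open>Once \<open>Q s\<close> has been reached, heavy edges lead towards the still missing
  \<open>Z\<close>, so the algorithm never has to use an edge lighter than \<open>s\<close>.\<close>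

lemma prim_suffix:
  assumes "prim V Ks" "last Ks = Z"
  obtains n where "n < length Ks" "\<And>i. i < length Ks \<Longrightarrow> Ks ! i \<in> Q s \<longleftrightarrow> n \<le> i"
proof -
  have dist: "distinct Ks" and set_Ks: "set Ks = V" using assms by (auto simp: prim_def)
  have ne: "Ks \<noteq> []" using set_Ks Z_in_V by auto
  have Z_nth: "Ks ! (length Ks - 1) = Z" using assms(2) ne by (simp add: last_conv_nth)
  define n where "n = (LEAST i. i < length Ks \<and> Ks ! i \<in> Q s)"
  have ex: "\<exists>i. i < length Ks \<and> Ks ! i \<in> Q s"
    using Z_nth Z_in_Q ne by (intro exI[of _ "length Ks - 1"]) simp
  have n: "n < length Ks" "Ks ! n \<in> Q s" unfolding n_def using LeastI_ex[OF ex] by auto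
  have before: "Ks ! i \<notin> Q s" if "i < n" for i
    using not_less_Least[of i "\<lambda>i. i < length Ks \<and> Ks ! i \<in> Q s"] that n(1) n_def by auto
  \<comment> \<open>With such an edge available, the clique at position \<open>n\<close> would
    itself be attached by a heavy edge, which puts its parent, at an earlier position, into
    \<open>Q s\<close>.\<close>
  have closed: "\<not> (j < n \<and> n \<le> i \<and> i < length Ks \<and> (Ks ! j, Ks ! i) \<in> upper s)" for i j
  proof
    assume H: "j < n \<and> n \<le> i \<and> i < length Ks \<and> (Ks ! j, Ks ! i) \<in> upper s"
    have "Ks ! j \<in> set (take n Ks)" "Ks ! i \<notin> set (take n Ks)" "Ks ! i \<in> V"
      using H n(1) dist set_Ks by (auto simp: in_set_take_iff)
    moreover have "0 < n" using H by simp
    moreover have "(Ks ! j, Ks ! i) \<in> (upper s)\<^sup>*" using H by (intro r_into_rtrancl) simp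
    ultimately obtain k where "k < n" "(Ks ! k, Ks ! n) \<in> upper s"
      using prim_parent[OF assms(1) _ n(1)] by metis
    then show False
      using Q_closed'[OF n(2), of "Ks ! k"] before by (simp add: upper_def)
  qed
  have after: "Ks ! i \<in> Q s" if "n \<le> i" "i < length Ks" for i
    using that
  proof (induction i rule: less_induct)
    case (less i)
    show ?case
    proof (cases "i = n \<or> i = length Ks - 1")
      case True
      then show ?thesis using n Z_nth Z_in_Q by metis
    next
      case False
      then have i: "n < i" "i < length Ks - 1" using less.prems by auto
      have "Ks ! n \<in> set (take i Ks)" "Z \<notin> set (take i Ks)"
        using i dist less.prems(2) n(1) in_set_take_iff[OF dist, of "length Ks - 1" i] Z_nth
        by (auto simp: in_set_take_iff)
      moreover have "0 < i" using i by simp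
      ultimately obtain j where j: "j < i" "(Ks ! j, Ks ! i) \<in> upper s"
        using prim_parent[OF assms(1) _ less.prems(2)] Z_in_V Q_upper_path[OF n(2) Z_in_Q]
        by metis
      then have "n \<le> j" using closed less.prems by (meson not_le)
      then have "Ks ! j \<in> Q s" using less j by auto
      then show ?thesis using j Q_closed by (auto simp: upper_def)
    qed
  qed
  show thesis using that[of n] n before after by (meson not_le)
qed

text \<open>Suppose an edge from \<open>X\<close> to \<open>Y\<close> enters with a label
  \<open>R\<close> other than the label \<open>S\<close> of the entry edge; both have
  \<open>t\<close> elements. Deleting the labels inside \<open>R\<close> separates \<open>X\<close>
  from \<open>Y\<close>, but not \<open>A\<close>. The layer is built contiguously by edges of
  weight at least \<open>t\<close>, so some such edge changes sides. Its label must be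
  \<open>R\<close>, and its end on the side of \<open>Y\<close> is then joined to \<open>Y\<close>
  by edges heavier than \<open>t\<close>, although it lies outside \<open>Q (Suc t)\<close>.\<close>

lemma prim_entry:
  assumes "prim V Ks" "last Ks = Z" "jump t"
  shows "\<exists>n<length Ks. (\<forall>i<length Ks. Ks ! i \<in> Q (Suc t) \<longleftrightarrow> n \<le> i) \<and>
    (\<exists>A\<in>Q t - Q (Suc t). (A, Ks ! n) \<in> E \<and>
      (\<forall>X\<in>Q t - Q (Suc t). \<forall>Y\<in>Q (Suc t). (X, Y) \<in> E \<longrightarrow> X \<inter> Y = A \<inter> Ks ! n))"
proof -
  have dist: "distinct Ks" and set_Ks: "set Ks = V" using assms by (auto simp: prim_def)
  obtain n where n: "n < length Ks" "\<And>i. i < length Ks \<Longrightarrow> Ks ! i \<in> Q (Suc t) \<longleftrightarrow> n \<le> i"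
    using prim_suffix[OF assms(1,2)] by metis
  obtain n0 where n0: "n0 < length Ks" "\<And>i. i < length Ks \<Longrightarrow> Ks ! i \<in> Q t \<longleftrightarrow> n0 \<le> i"
    using prim_suffix[OF assms(1,2)] by metis
  have index: "\<exists>i. i < n \<and> n0 \<le> i \<and> X = Ks ! i" if X: "X \<in> Q t - Q (Suc t)" for X
  proof -
    obtain i where "i < length Ks" "X = Ks ! i"
      using X Q_subset_V set_Ks by (metis DiffD1 in_set_conv_nth subsetD)
    then show ?thesis using X n n0 by (metis DiffD1 DiffD2 not_le)
  qed
  have not_later: "Y \<notin> set (take n Ks)" if Y: "Y \<in> Q (Suc t)" for Y
    using Y n by (auto simp: in_set_conv_nth)
  obtain X0 Y0 where XY0: "(X0, Y0) \<in> E" "X0 \<in> Q t - Q (Suc t)" "Y0 \<in> Q (Suc t)"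
    using jump_crossing[OF assms(3)] by metis
  have n0n: "n0 < n" using index[OF XY0(2)] by auto
  have "(X0, Y0) \<in> (upper t)\<^sup>*"
    using XY0 crossing_weight[OF XY0] by (auto simp: upper_def)
  moreover have "X0 \<in> set (take n Ks)"
    using index[OF XY0(2)] n(1) dist by (auto simp: in_set_take_iff)
  moreover have "0 < n" using n0n by simp
  ultimately obtain j where j: "j < n" "(Ks ! j, Ks ! n) \<in> upper t"
    using prim_parent[OF assms(1) _ n(1)] not_later[OF XY0(3)] E_D(2)[OF XY0(1)] by metis
  define A where "A = Ks ! j"
  have B: "Ks ! n \<in> Q (Suc t)" using n by simp
  have A: "(A, Ks ! n) \<in> E" "A \<in> Q t - Q (Suc t)"
    using j n Q_closed'[of "Ks ! n" t A] B Q_Suc_subset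
    by (auto simp: A_def upper_def)
  define S where "S = A \<inter> Ks ! n"
  have card_S: "card S = t" using crossing_weight[OF A B] by (simp add: S_def)
  have "X \<inter> Y = S" if XY: "(X, Y) \<in> E" "X \<in> Q t - Q (Suc t)" "Y \<in> Q (Suc t)" for X Y
  proof (rule ccontr)
    assume neq: "X \<inter> Y \<noteq> S"
    define R where "R = X \<inter> Y"
    have card_R: "card R = t" using crossing_weight[OF XY] by (simp add: R_def)
    have finR: "finite R" unfolding R_def using XY finite_label by blast
    define r where "r = {(X, Y) \<in> E. \<not> X \<inter> Y \<subseteq> R}"
    \<comment> \<open>The side of \<open>Y\<close> after the deletion. It contains all of
      \<open>Q (Suc t)\<close>, which is connected by edges too heavy to be deleted.\<close>
    define C where "C = {W. (Y, W) \<in> r\<^sup>*}"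
    have symr: "sym (r\<^sup>*)" unfolding r_def
      by (intro sym_rtrancl symI) (auto simp: Int_commute dest: E_symD)
    have up: "(upper (Suc t))\<^sup>* \<subseteq> r\<^sup>*"
      unfolding r_def using card_R finR by (intro rtrancl_mono upper_avoids) auto
    have "Ks ! n \<in> C" using Q_upper_path[OF XY(3) B] up by (auto simp: C_def)
    moreover have "\<not> S \<subseteq> R" using card_subset_eq[OF finR, of S] card_R card_S neq R_def by auto
    then have "(Ks ! n, A) \<in> r" using A E_symD by (auto simp: r_def S_def)
    ultimately have AC: "A \<in> C" by (auto simp: C_def)
    have XC: "X \<notin> C"
    proof
      assume "X \<in> C"
      then have "(X, Y) \<in> r\<^sup>*" using symr by (auto simp: C_def dest: symD)
      then show False using edge_separates[OF XY(1)] by (simp add: r_def R_def)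
    qed
    obtain a where a: "a < n" "n0 \<le> a" "A = Ks ! a" using index[OF A(2)] by blast
    obtain x where x: "x < n" "n0 \<le> x" "X = Ks ! x" using index[OF XY(2)] by blast
    \<comment> \<open>Positions on the other side than the first clique of the layer; one of
      \<open>a\<close> and \<open>x\<close> is such a position.\<close>
    define bad where "bad i \<longleftrightarrow> n0 \<le> i \<and> (Ks ! i \<in> C) \<noteq> (Ks ! n0 \<in> C)" for i
    have ex: "\<exists>m<n. bad m" using a x AC XC by (auto simp: bad_def)
    define m where "m = (LEAST m. m < n \<and> bad m)"
    have m: "m < n" "bad m" using LeastI_ex[OF ex] by (auto simp: m_def)
    have m_min: "\<not> bad i" if "i < m" for i
      using not_less_Least[of i "\<lambda>m. m < n \<and> bad m"] that m(1) unfolding m_def by auto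
    have "n0 \<noteq> m" using m by (auto simp: bad_def)
    then have n0m: "n0 < m" using m by (auto simp: bad_def)
    have len: "m < length Ks" using m n(1) by simp
    have "Ks ! n0 \<in> set (take m Ks)" "Ks ! m \<notin> set (take m Ks)" "Ks ! m \<in> V"
      using n0m len dist set_Ks n0(1) by (auto simp: in_set_take_iff)
    moreover have "(Ks ! n0, Ks ! m) \<in> (upper t)\<^sup>*"
      using n0 n0m len by (intro Q_upper_path) auto
    moreover have "0 < m" using n0m by simp
    ultimately obtain k where k: "k < m" "(Ks ! k, Ks ! m) \<in> upper t"
      using prim_parent[OF assms(1) _ len] by metis
    have "Ks ! k \<in> Q t"
      using k n0(2)[OF len] n0m Q_closed'[of "Ks ! m" t "Ks ! k"] by (auto simp: upper_def)
    then have n0k: "n0 \<le> k" using n0(2)[of k] k len by simp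
    then have diff: "(Ks ! k \<in> C) \<noteq> (Ks ! m \<in> C)"
      using m m_min[OF k(1)] by (auto simp: bad_def)
    have sub: "Ks ! k \<inter> Ks ! m \<subseteq> R"
    proof (rule ccontr)
      assume "\<not> Ks ! k \<inter> Ks ! m \<subseteq> R"
      then have "(Ks ! k, Ks ! m) \<in> r" using k by (auto simp: r_def upper_def)
      then have "(Ks ! k, Ks ! m) \<in> r\<^sup>*" "(Ks ! m, Ks ! k) \<in> r\<^sup>*" using symr by (auto dest: symD)
      then show False using diff unfolding C_def by (metis mem_Collect_eq rtrancl_trans)
    qed
    \<comment> \<open>Contained in \<open>R\<close> and no smaller, because the attaching edge
      weighs at least \<open>t\<close>.\<close>
    have "Ks ! k \<inter> Ks ! m = R"
      using sub finR card_R k(2) by (intro card_seteq) (auto simp: upper_def)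
    then have R_sub: "R \<subseteq> Ks ! k" "R \<subseteq> Ks ! m" by blast+
    have "Ks ! k \<in> Q t - Q (Suc t)" "Ks ! m \<in> Q t - Q (Suc t)"
      using n n0 n0k n0m k(1) m(1) len by auto
    then obtain W where W: "R \<subseteq> W" "W \<in> C" "W \<in> Q t - Q (Suc t)"
      using diff R_sub by blast
    have "(Y, W) \<in> {(X, Y) \<in> E. R \<subset> X \<inter> Y}\<^sup>*"
      using W XY(3) Q_subset_V by (intro supset_path) (auto simp: R_def C_def r_def)
    then have "(Y, W) \<in> (upper (Suc t))\<^sup>*" using supset_path_upper card_R by blast
    then show False using W XY(3) Q_upper_rtrancl by blast
  qed
  then have "\<forall>X\<in>Q t - Q (Suc t). \<forall>Y\<in>Q (Suc t). (X, Y) \<in> E \<longrightarrow> X \<inter> Y = A \<inter> Ks ! n"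
    by (simp add: S_def)
  then show ?thesis using n A by blast
qed

text \<open>Edges from the layer are settled by \<open>prim_entry\<close>; those from farther out
  follow by induction from heavy to light. A label \<open>R\<close> of size \<open>r\<close> below
  \<open>t\<close> is the entry label at \<open>r\<close>, so it lies in the first clique of
  \<open>Q (Suc r)\<close> in the ordering. That clique is outside \<open>Q (Suc t)\<close>, and a
  path to it with labels properly containing \<open>R\<close> leaves \<open>Q (Suc t)\<close> by a
  heavier edge, which the induction covers.\<close>

lemma prim_lev:
  assumes "prim V Ks" "last Ks = Z" "jump t"
  obtains S where "lev t S"
proof -
  have set_Ks: "set Ks = V" using assms by (auto simp: prim_def)
  obtain n A where n: "n < length Ks" "\<forall>i<length Ks. Ks ! i \<in> Q (Suc t) \<longleftrightarrow> n \<le> i"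
    and A: "A \<in> Q t - Q (Suc t)" "(A, Ks ! n) \<in> E"
    and cross: "\<forall>X\<in>Q t - Q (Suc t). \<forall>Y\<in>Q (Suc t). (X, Y) \<in> E \<longrightarrow> X \<inter> Y = A \<inter> Ks ! n"
    using prim_entry[OF assms] by blast
  define S where "S = A \<inter> Ks ! n"
  have "X \<inter> Y \<subseteq> S" if "(X, Y) \<in> E" "X \<notin> Q (Suc t)" "Y \<in> Q (Suc t)" for X Y
    using that
  proof (induction "t - card (X \<inter> Y)" arbitrary: X Y rule: less_induct)
    case less
    define R where "R = X \<inter> Y"
    define r where "r = card R"
    have rt: "r < Suc t" using crossing_weight_less[OF less.prems] by (simp add: r_def R_def)
    show ?case
    proof (cases "X \<in> Q t")
      case True
      then show ?thesis using cross less.prems by (simp add: S_def)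
    next
      case False
      then have "r \<noteq> t"
        using Q_closed'[of Y t X] less.prems Q_Suc_subset by (auto simp: r_def R_def)
      then have rt: "r < t" using rt by simp
      have Y: "Y \<in> Q (Suc r)" "Y \<in> Q r"
        using less.prems(3) Q_antimono[of "Suc r" "Suc t"] Q_antimono[of r "Suc t"] rt by auto
      have "X \<in> Q r" using Q_closed'[OF Y(2) less.prems(1)] by (simp add: r_def R_def)
      moreover have "X \<notin> Q (Suc r)"
        using inner_weight[OF _ Y(1) less.prems(1)] by (auto simp: r_def R_def)
      ultimately have X: "X \<in> Q r - Q (Suc r)" by blast
      then have "jump r" by (auto simp: jump_def)
      obtain n' A' where n': "n' < length Ks"
          "\<forall>i<length Ks. Ks ! i \<in> Q (Suc r) \<longleftrightarrow> n' \<le> i"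
        and cross': "\<forall>X\<in>Q r - Q (Suc r). \<forall>Y\<in>Q (Suc r). (X, Y) \<in> E \<longrightarrow> X \<inter> Y = A' \<inter> Ks ! n'"
        using prim_entry[OF assms(1,2) \<open>jump r\<close>] by blast
      have RB: "R \<subseteq> Ks ! n'" using cross' less.prems(1) X Y(1) by (auto simp: R_def)
      have B: "Ks ! n' \<in> Q (Suc r)" using n' by simp
      \<comment> \<open>A clique \<open>W\<close> of the layer at \<open>t\<close> stands at or
        after position \<open>n'\<close> but before position \<open>n\<close>.\<close>
      have "Ks ! n' \<notin> Q (Suc t)"
      proof
        assume "Ks ! n' \<in> Q (Suc t)"
        then have "n \<le> n'" using n n' by blast
        obtain W where W: "W \<in> Q t" "W \<notin> Q (Suc t)"
          using assms(3) Q_Suc_subset by (auto simp: jump_def)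
        then obtain i where i: "i < length Ks" "W = Ks ! i"
          using Q_subset_V set_Ks by (metis in_set_conv_nth subsetD)
        have "W \<in> Q (Suc r)" using W Q_antimono[of "Suc r" t] rt by auto
        then show False using i W n n' \<open>n \<le> n'\<close> by (metis le_trans)
      qed
      moreover have "(Y, Ks ! n') \<in> {(X, Y) \<in> E. R \<subset> X \<inter> Y}\<^sup>*"
      proof (rule supset_path)
        have "finite R" unfolding R_def using less.prems finite_label by blast
        then have "(upper (Suc r))\<^sup>* \<subseteq> {(X, Y) \<in> E. \<not> X \<inter> Y \<subseteq> R}\<^sup>*"
          by (intro rtrancl_mono upper_avoids) (auto simp: r_def)
        then show "(Y, Ks ! n') \<in> {(X, Y) \<in> E. \<not> X \<inter> Y \<subseteq> R}\<^sup>*"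
          using Q_upper_path[OF Y(1) B] by blast
      qed (use RB B Y Q_subset_V in \<open>auto simp: R_def\<close>)
      ultimately obtain Y' X' where XY': "(Y', X') \<in> E" "R \<subset> Y' \<inter> X'" "Y' \<in> Q (Suc t)" "X' \<notin> Q (Suc t)"
        using rtrancl_exit[OF _ less.prems(3)] by (smt (verit) case_prodD mem_Collect_eq)
      have "card R < card (X' \<inter> Y')"
        using XY' finite_label by (metis Int_commute psubset_card_mono)
      moreover have "card (X' \<inter> Y') < Suc t"
        using XY' E_symD by (intro crossing_weight_less) auto
      ultimately have "X' \<inter> Y' \<subseteq> S"
        using XY' E_symD by (intro less.hyps) (auto simp: R_def)
      then show ?thesis using XY' by (auto simp: R_def)
    qed
  qed
  moreover have "Ks ! n \<in> Q (Suc t)" using n by simp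
  ultimately have "lev t S" unfolding lev_def using A S_def by blast
  then show thesis by (rule that)
qed

subsection \<open>From levels to Prim orderings\<close>

definition levels :: bool where
  "levels \<longleftrightarrow> (\<forall>t. jump t \<longrightarrow> (\<exists>S. lev t S))"

lemma prim_levels: "\<lbrakk>prim V Ks; last Ks = Z\<rbrakk> \<Longrightarrow> levels"
  unfolding levels_def by (metis prim_lev)

lemma Q_inner_path:
  assumes "X \<in> Q s" "Y \<in> Q s"
  shows "(X, Y) \<in> (E \<inter> Q s \<times> Q s)\<^sup>*"
proof -
  have "(X, Y) \<in> (upper s)\<^sup>*" using assms by (rule Q_upper_path)
  then have "Y \<in> Q s \<and> (X, Y) \<in> (E \<inter> Q s \<times> Q s)\<^sup>*"
  proof (induction rule: rtrancl_induct)
    case base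
    then show ?case using assms by simp
  next
    case (step Y W)
    then have "(Y, W) \<in> E" "W \<in> Q s"
      using Q_closed[of Y s W] by (auto simp: upper_def)
    then have "(Y, W) \<in> E \<inter> Q s \<times> Q s" using step.IH by simp
    then show ?case using step.IH \<open>W \<in> Q s\<close> by (metis rtrancl.rtrancl_into_rtrancl)
  qed
  then show ?thesis ..
qed

lemma sym_rtrancl_induced: "sym ((E \<inter> W \<times> W)\<^sup>*)"
proof (rule sym_rtrancl[OF symI])
  fix A B assume "(A, B) \<in> E \<inter> W \<times> W"
  then show "(B, A) \<in> E \<inter> W \<times> W" using E_symD[of A B] by simp
qed

text \<open>\<open>Q (Suc t)\<close> is closed under edges of weight above \<open>t\<close>, so a
  path of such edges that starts outside cannot enter it.\<close>

lemma upper_path_in_layer: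
  assumes "A \<in> Q t - Q (Suc t)" "(A, B) \<in> (upper (Suc t))\<^sup>*"
  shows "(A, B) \<in> (E \<inter> (Q t - Q (Suc t)) \<times> (Q t - Q (Suc t)))\<^sup>*"
proof -
  let ?W = "Q t - Q (Suc t)"
  have "B \<in> ?W \<and> (A, B) \<in> (E \<inter> ?W \<times> ?W)\<^sup>*"
    using assms(2)
  proof (induction rule: rtrancl_induct)
    case base
    then show ?case using assms(1) by simp
  next
    case (step X Y)
    then have XY: "(X, Y) \<in> E" "Suc t \<le> card (X \<inter> Y)" by (auto simp: upper_def)
    then have "Y \<in> Q t" "Y \<notin> Q (Suc t)"
      using step.IH Q_closed[of X t Y] Q_closed'[of Y "Suc t" X] by auto
    then have "(X, Y) \<in> E \<inter> ?W \<times> ?W" using step.IH XY by simp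
    then show ?case using step.IH \<open>Y \<in> Q t\<close> \<open>Y \<notin> Q (Suc t)\<close>
      by (metis DiffI rtrancl.rtrancl_into_rtrancl)
  qed
  then show ?thesis ..
qed

text \<open>Every clique of the layer reaches, within the layer, one containing \<open>S\<close>:
  the last before a path to \<open>Z\<close> enters \<open>Q (Suc t)\<close>. Two cliques containing
  \<open>S\<close> are adjacent or joined by edges heavier than \<open>t\<close>, which stay in the
  layer.\<close>

lemma layer_connected:
  assumes "lev t S" "X \<in> Q t - Q (Suc t)" "Y \<in> Q t - Q (Suc t)"
  shows "(X, Y) \<in> (E \<inter> (Q t - Q (Suc t)) \<times> (Q t - Q (Suc t)))\<^sup>*"
proof -
  define W where "W = Q t - Q (Suc t)"
  have gate: "\<exists>P\<in>W. S \<subseteq> P \<and> (X, P) \<in> (E \<inter> W \<times> W)\<^sup>*" if "X \<in> W" for X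
  proof -
    have "(X, Z) \<in> (E \<inter> Q t \<times> Q t)\<^sup>*" "X \<in> - Q (Suc t)" "Z \<notin> - Q (Suc t)"
      using that Z_in_Q Q_inner_path by (auto simp: W_def)
    then obtain P P' where P: "(P, P') \<in> E \<inter> Q t \<times> Q t" "P \<in> - Q (Suc t)" "P' \<notin> - Q (Suc t)"
      and path: "(X, P) \<in> (E \<inter> Q t \<times> Q t \<inter> (- Q (Suc t)) \<times> (- Q (Suc t)))\<^sup>*"
      by (rule rtrancl_exit)
    have "P \<inter> P' = S" using P by (intro lev_crossing[OF assms(1)]) auto
    moreover have "(X, P) \<in> (E \<inter> W \<times> W)\<^sup>*"
      by (rule rtrancl_subsetD[OF path]) (auto simp: W_def)
    ultimately show ?thesis using P by (auto simp: W_def)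
  qed
  obtain P where P: "P \<in> W" "S \<subseteq> P" "(X, P) \<in> (E \<inter> W \<times> W)\<^sup>*"
    using gate assms(2) W_def by blast
  obtain R where R: "R \<in> W" "S \<subseteq> R" "(Y, R) \<in> (E \<inter> W \<times> W)\<^sup>*"
    using gate assms(3) W_def by blast
  have "P \<in> V" "R \<in> V" using P R Q_subset_V by (auto simp: W_def)
  then have "(P, R) \<in> E \<or> (P, R) \<in> (upper (Suc t))\<^sup>*"
    using supsets_edge_or_path[of P R S] P R lev_card[OF assms(1)] by simp
  then have "(P, R) \<in> (E \<inter> W \<times> W)\<^sup>*"
  proof
    assume "(P, R) \<in> E"
    then have "(P, R) \<in> E \<inter> W \<times> W" using P R by simp
    then show ?thesis ..
  next
    assume "(P, R) \<in> (upper (Suc t))\<^sup>*"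
    then show ?thesis using upper_path_in_layer[of P t R] P by (simp add: W_def)
  qed
  moreover have "(R, Y) \<in> (E \<inter> W \<times> W)\<^sup>*" using R(3) sym_rtrancl_induced by (metis symD)
  ultimately have "(X, Y) \<in> (E \<inter> W \<times> W)\<^sup>*" using P(3) by (meson rtrancl_trans)
  then show ?thesis by (simp add: W_def)
qed

text \<open>For \<open>s = 0\<close> these turn out to be the first cliques of Prim orderings that end with \<open>Z\<close>.\<close>

definition start :: "nat \<Rightarrow> 'a set \<Rightarrow> bool" where
  "start s K \<longleftrightarrow> K \<in> Q s \<and> (\<forall>s'. Q s' \<subset> Q s \<longrightarrow> K \<notin> Q s')"

text \<open>A component properly inside \<open>Q t\<close> belongs to a threshold of at least
  \<open>Suc t\<close>, so avoiding \<open>Q (Suc t)\<close> suffices.\<close>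

lemma start_first_jump:
  assumes "jump t" "Q t = Q s"
  shows "start s K \<longleftrightarrow> K \<in> Q t - Q (Suc t)"
proof
  assume "start s K"
  moreover have "Q (Suc t) \<subset> Q s" using assms Q_Suc_subset by (auto simp: jump_def)
  ultimately show "K \<in> Q t - Q (Suc t)" using assms by (auto simp: start_def)
next
  assume K: "K \<in> Q t - Q (Suc t)"
  have "K \<notin> Q s'" if "Q s' \<subset> Q s" for s'
  proof -
    have "Suc t \<le> s'"
      using that assms(2) Q_antimono[of s' t] not_less_eq_eq[of s' t] by auto
    then show ?thesis using K Q_antimono by blast
  qed
  then show "start s K" using K assms by (auto simp: start_def)
qed

lemma start_exists: obtains K where "start s K"
proof (cases "Q s = {Z}")
  case True
  then have "start s Z" using Z_in_Q by (auto simp: start_def)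
  then show thesis by (rule that)
next
  case False
  then obtain t where t: "jump t" "Q t = Q s" using next_jump by metis
  then obtain K where "K \<in> Q t - Q (Suc t)" using Q_Suc_subset by (auto simp: jump_def)
  then show thesis using start_first_jump[OF t] that by blast
qed

text \<open>The entry must end where an ordering of \<open>Q (Suc t)\<close> may start. If
  \<open>B0\<close> lies too deep, in \<open>Q (Suc u)\<close> for the next jump \<open>u\<close>,
  the edge from \<open>A0\<close> to \<open>B0\<close> also crosses level \<open>u\<close>, so
  \<open>S\<close> is contained in the label \<open>S'\<close>. A clique \<open>A1\<close> of the
  layer at \<open>u\<close> containing \<open>S'\<close> shares \<open>S\<close> with
  \<open>A0\<close>. A heavy path between them would put \<open>A0\<close> into
  \<open>Q (Suc t)\<close>; hence they are adjacent, and \<open>A1\<close> replaces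
  \<open>B0\<close>.\<close>

lemma entry_edge:
  assumes levels "lev t S"
  obtains A B where "(A, B) \<in> E" "A \<in> Q t - Q (Suc t)" "start (Suc t) B" "A \<inter> B = S"
proof -
  obtain A0 B0 where AB0: "(A0, B0) \<in> E" "A0 \<in> Q t - Q (Suc t)" "B0 \<in> Q (Suc t)" "A0 \<inter> B0 = S"
    using assms(2) by (auto simp: lev_def)
  show thesis
  proof (cases "Q (Suc t) = {Z}")
    case True
    then have "start (Suc t) B0" using AB0(3) Z_in_Q by (auto simp: start_def)
    then show thesis using AB0 that by simp
  next
    case False
    then obtain u where u: "jump u" "Q u = Q (Suc t)" using next_jump by metis
    note start_iff = start_first_jump[OF u]
    obtain S' where S': "lev u S'" using assms(1) u(1) by (auto simp: levels_def)
    show thesis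
    proof (cases "B0 \<in> Q (Suc u)")
      case False
      then show thesis using AB0 that u(2) start_iff by simp
    next
      case True
      have "A0 \<notin> Q (Suc u)" using AB0(2) u(2) Q_Suc_subset[of u] by auto
      then have "S \<subseteq> S'" using lev_crossing_subset[OF S' AB0(1)] True AB0(4) by simp
      obtain A1 B1 where AB1: "A1 \<in> Q u - Q (Suc u)" "A1 \<inter> B1 = S'"
        using S' by (auto simp: lev_def)
      have "(A0, A1) \<in> E \<or> (A0, A1) \<in> (upper (Suc (card S)))\<^sup>*"
        using AB0 AB1 \<open>S \<subseteq> S'\<close> Q_subset_V by (intro supsets_edge_or_path) blast+
      moreover have "(A0, A1) \<notin> (upper (Suc (card S)))\<^sup>*"
      proof
        assume "(A0, A1) \<in> (upper (Suc (card S)))\<^sup>*"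
        then have "(A1, A0) \<in> (upper (Suc t))\<^sup>*"
          using upper_rtrancl_symD lev_card[OF assms(2)] by simp
        then have "A0 \<in> Q (Suc t)" using AB1(1) u(2) by (auto intro: Q_upper_rtrancl)
        then show False using AB0(2) by simp
      qed
      ultimately have "(A0, A1) \<in> E" by simp
      moreover have "A1 \<in> Q (Suc t)" using AB1(1) u(2) by simp
      ultimately have "A0 \<inter> A1 = S" using AB0(2) by (intro lev_crossing[OF assms(2)])
      then show thesis using that[of A0 A1] \<open>(A0, A1) \<in> E\<close> AB0(2) AB1(1) start_iff by simp
    qed
  qed
qed

text \<open>Prim's algorithm restricted to a connected set can start anywhere and never gets stuck:
  a path from \<open>K\<close> to a missing clique leaves the included ones.\<close>

lemma connected_prim:
  assumes W: "W \<subseteq> V" "K \<in> W" and conn: "\<And>X. X \<in> W \<Longrightarrow> (K, X) \<in> (E \<inter> W \<times> W)\<^sup>*"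
  obtains Ks where "prim W Ks" "Ks \<noteq> []" "hd Ks = K"
proof -
  have finW: "finite W" using W finite_V finite_subset by blast
  define part where "part Ks \<longleftrightarrow> distinct Ks \<and> set Ks \<subseteq> W \<and> Ks \<noteq> [] \<and> hd Ks = K \<and>
    (\<forall>i. 0 < i \<and> i < length Ks \<longrightarrow>
      (\<exists>A\<in>set (take i Ks). (A, Ks ! i) \<in> E \<and>
        (\<forall>X\<in>set (take i Ks). \<forall>Y\<in>W - set (take i Ks).
          (X, Y) \<in> E \<longrightarrow> card (X \<inter> Y) \<le> card (A \<inter> Ks ! i))))" for Ks
  have extend: "\<exists>Y. part (Ks @ [Y])" if Ks: "part Ks" "set Ks \<noteq> W" for Ks
  proof -
    let ?c = "E \<inter> set Ks \<times> (W - set Ks)"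
    obtain X where "X \<in> W" "X \<notin> set Ks" using Ks by (auto simp: part_def)
    moreover have "K \<in> set Ks" using Ks by (auto simp: part_def)
    ultimately obtain x y where "(x, y) \<in> E \<inter> W \<times> W" "x \<in> set Ks" "y \<notin> set Ks"
      using rtrancl_exit[OF conn] by metis
    then have ne: "?c \<noteq> {}" by blast
    have fin: "finite ?c"
      using finW by (intro finite_subset[of ?c "set Ks \<times> W"]) auto
    define m where "m = Max ((\<lambda>(A, B). card (A \<inter> B)) ` ?c)"
    have "m \<in> (\<lambda>(A, B). card (A \<inter> B)) ` ?c" unfolding m_def using ne fin by (intro Max_in) auto
    then obtain A B where AB: "(A, B) \<in> E" "A \<in> set Ks" "B \<in> W - set Ks" "card (A \<inter> B) = m" by auto
    have max: "\<forall>X\<in>set Ks. \<forall>Y\<in>W - set Ks. (X, Y) \<in> E \<longrightarrow> card (X \<inter> Y) \<le> card (A \<inter> B)"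
    proof (intro ballI impI)
      fix X Y assume "X \<in> set Ks" "Y \<in> W - set Ks" "(X, Y) \<in> E"
      then have "card (X \<inter> Y) \<in> (\<lambda>(A, B). card (A \<inter> B)) ` ?c"
        by (intro image_eqI[of _ _ "(X, Y)"]) auto
      then show "card (X \<inter> Y) \<le> card (A \<inter> B)" unfolding AB(4) m_def using fin by simp
    qed
    have "part (Ks @ [B])"
      unfolding part_def
    proof (intro conjI allI impI)
      fix i assume i: "0 < i \<and> i < length (Ks @ [B])"
      show "\<exists>A\<in>set (take i (Ks @ [B])). (A, (Ks @ [B]) ! i) \<in> E \<and>
        (\<forall>X\<in>set (take i (Ks @ [B])). \<forall>Y\<in>W - set (take i (Ks @ [B])).
          (X, Y) \<in> E \<longrightarrow> card (X \<inter> Y) \<le> card (A \<inter> (Ks @ [B]) ! i))"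
      proof (cases "i < length Ks")
        case True
        then show ?thesis using Ks i by (simp add: part_def nth_append)
      next
        case False
        then have "i = length Ks" using i by simp
        then show ?thesis using AB max by auto
      qed
    qed (use Ks AB in \<open>auto simp: part_def\<close>)
    then show ?thesis ..
  qed
  have "part Ks \<Longrightarrow> \<exists>Ks'. part Ks' \<and> set Ks' = W" for Ks
  proof (induction "card W - length Ks" arbitrary: Ks rule: less_induct)
    case less
    show ?case
    proof (cases "set Ks = W")
      case False
      then obtain Y where Y: "part (Ks @ [Y])" using extend less.prems by blast
      then have "length (Ks @ [Y]) \<le> card W"
        using card_mono[OF finW, of "set (Ks @ [Y])"] by (simp only: part_def distinct_card)
      then show ?thesis using less.hyps[OF _ Y] by simp
    qed (use less.prems in blast)
  qed
  moreover have "part [K]" using W by (auto simp: part_def)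
  ultimately obtain Ks where "part Ks" "set Ks = W" by blast
  then have "prim W Ks" "Ks \<noteq> []" "hd Ks = K" by (simp_all add: part_def prim_def)
  then show thesis by (rule that)
qed

text \<open>Edges inside the layer weigh at least \<open>t\<close>, edges between the layer and
  \<open>Q (Suc t)\<close> exactly \<open>t\<close>, and edges inside \<open>Q (Suc t)\<close> more
  than \<open>t\<close>. So a crossing edge never beats the edge chosen inside the current part;
  ties at \<open>t\<close> are broken in favour of the layer.\<close>

lemma prim_append:
  assumes Ks: "prim (Q t - Q (Suc t)) Ks" "Ks \<noteq> []" and Ls: "prim (Q (Suc t)) Ls" "Ls \<noteq> []"
    and edge: "(A, hd Ls) \<in> E" "A \<in> Q t - Q (Suc t)"
  shows "prim (Q t) (Ks @ Ls)"
  unfolding prim_def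
proof (intro conjI allI impI)
  let ?W = "Q t - Q (Suc t)"
  have dist: "distinct Ks" "distinct Ls" and sets: "set Ks = ?W" "set Ls = Q (Suc t)"
    using Ks Ls by (auto simp: prim_def)
  show "distinct (Ks @ Ls)" using dist sets by auto
  show "set (Ks @ Ls) = Q t" using sets Q_Suc_subset by auto
  have low: "card (X \<inter> Y) \<le> t" if "(X, Y) \<in> E" "X \<in> ?W" "Y \<in> Q (Suc t)" for X Y
    using crossing_weight[OF that] by simp
  fix i assume i: "0 < i \<and> i < length (Ks @ Ls)"
  consider "i < length Ks" | "i = length Ks" | j where "i = length Ks + j" "0 < j" "j < length Ls"
    using i by (metis add_diff_inverse_nat length_append nat_add_left_cancel_less
        linorder_neqE_nat not_less zero_less_diff)
  then show "\<exists>A\<in>set (take i (Ks @ Ls)). (A, (Ks @ Ls) ! i) \<in> E \<and>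
      (\<forall>X\<in>set (take i (Ks @ Ls)). \<forall>Y\<in>Q t - set (take i (Ks @ Ls)).
        (X, Y) \<in> E \<longrightarrow> card (X \<inter> Y) \<le> card (A \<inter> (Ks @ Ls) ! i))"
  proof cases
    case 1
    have "\<exists>A\<in>set (take i Ks). (A, Ks ! i) \<in> E \<and>
        (\<forall>X\<in>set (take i Ks). \<forall>Y\<in>?W - set (take i Ks).
          (X, Y) \<in> E \<longrightarrow> card (X \<inter> Y) \<le> card (A \<inter> Ks ! i))"
      using Ks(1) 1 i by (simp add: prim_def)
    then obtain P where P: "P \<in> set (take i Ks)" "(P, Ks ! i) \<in> E"
      and max: "\<forall>X\<in>set (take i Ks). \<forall>Y\<in>?W - set (take i Ks).
          (X, Y) \<in> E \<longrightarrow> card (X \<inter> Y) \<le> card (P \<inter> Ks ! i)" by blast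
    have in_W: "set (take i Ks) \<subseteq> ?W" "Ks ! i \<in> ?W"
      using sets(1) set_take_subset[of i Ks] nth_mem[OF 1] by auto
    then have t: "t \<le> card (P \<inter> Ks ! i)" using P by (intro inner_weight) auto
    have "card (X \<inter> Y) \<le> card (P \<inter> Ks ! i)"
      if X: "X \<in> set (take i Ks)" and Y: "Y \<in> Q t - set (take i Ks)" and XY: "(X, Y) \<in> E" for X Y
    proof (cases "Y \<in> Q (Suc t)")
      case True
      then show ?thesis using low[OF XY] X in_W t by (meson le_trans subsetD)
    next
      case False
      then show ?thesis using max X Y XY by blast
    qed
    then show ?thesis using 1 P by (auto simp: nth_append)
  next
    case 2
    have "Ls ! 0 = hd Ls" using Ls(2) by (simp add: hd_conv_nth)
    then have "t \<le> card (A \<inter> Ls ! 0)"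
      using edge Ls(2) sets(2) Q_Suc_subset hd_in_set[OF Ls(2)] by (intro inner_weight) auto
    then have "card (X \<inter> Y) \<le> card (A \<inter> Ls ! 0)"
      if "X \<in> ?W" "Y \<in> Q t - ?W" "(X, Y) \<in> E" for X Y
      using low[OF that(3,1)] that by (auto intro: le_trans)
    then show ?thesis using 2 edge sets \<open>Ls ! 0 = hd Ls\<close> by (auto simp: nth_append)
  next
    case 3
    have "\<exists>A\<in>set (take j Ls). (A, Ls ! j) \<in> E \<and>
        (\<forall>X\<in>set (take j Ls). \<forall>Y\<in>Q (Suc t) - set (take j Ls).
          (X, Y) \<in> E \<longrightarrow> card (X \<inter> Y) \<le> card (A \<inter> Ls ! j))"
      using Ls(1) 3 by (simp add: prim_def)
    then obtain P where P: "P \<in> set (take j Ls)" "(P, Ls ! j) \<in> E"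
      and max: "\<forall>X\<in>set (take j Ls). \<forall>Y\<in>Q (Suc t) - set (take j Ls).
          (X, Y) \<in> E \<longrightarrow> card (X \<inter> Y) \<le> card (P \<inter> Ls ! j)" by blast
    have "P \<in> Q (Suc t)" "Ls ! j \<in> Q (Suc t)"
      using sets(2) set_take_subset[of j Ls] nth_mem[OF 3(3)] P by auto
    then have t: "Suc t \<le> card (P \<inter> Ls ! j)" using P by (intro inner_weight) auto
    have "card (X \<inter> Y) \<le> card (P \<inter> Ls ! j)"
      if X: "X \<in> set Ks \<union> set (take j Ls)" and Y: "Y \<in> Q t - (set Ks \<union> set (take j Ls))"
        and XY: "(X, Y) \<in> E" for X Y
    proof -
      have Y': "Y \<in> Q (Suc t) - set (take j Ls)" using Y sets(1) by auto
      show ?thesis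
      proof (cases "X \<in> set Ks")
        case True
        then show ?thesis using low[OF XY] Y' sets(1) t by auto
      next
        case False
        then show ?thesis using max X Y' XY by blast
      qed
    qed
    then show ?thesis using 3 P by (auto simp: nth_append)
  qed
qed

lemma levels_prim:
  assumes levels "start s K"
  obtains Ks where "prim (Q s) Ks" "Ks \<noteq> []" "hd Ks = K" "last Ks = Z"
proof -
  have "\<exists>Ks. prim (Q s) Ks \<and> Ks \<noteq> [] \<and> hd Ks = K \<and> last Ks = Z"
    using assms(2)
  proof (induction "card (Q s)" arbitrary: s K rule: less_induct)
    case less
    show ?case
    proof (cases "Q s = {Z}")
      case True
      then have "K = Z" using less.prems by (simp add: start_def)
      moreover have "prim (Q s) [Z]" using True by (auto simp: prim_def)
      ultimately show ?thesis by (intro exI[of _ "[Z]"]) simp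
    next
      case False
      then obtain t where t: "jump t" "Q t = Q s" using next_jump by metis
      obtain S where S: "lev t S" using assms(1) t(1) by (auto simp: levels_def)
      have K: "K \<in> Q t - Q (Suc t)" using less.prems start_first_jump[OF t] by simp
      obtain Ks where Ks: "prim (Q t - Q (Suc t)) Ks" "Ks \<noteq> []" "hd Ks = K"
      proof (rule connected_prim)
        show "Q t - Q (Suc t) \<subseteq> V" using Q_subset_V by blast
      qed (use K layer_connected[OF S K] in blast)+
      obtain A B where AB: "(A, B) \<in> E" "A \<in> Q t - Q (Suc t)" "start (Suc t) B"
        using entry_edge[OF assms(1) S] by metis
      have "card (Q (Suc t)) < card (Q s)"
        using t Q_Suc_subset[of t] finite_Q by (intro psubset_card_mono) (auto simp: jump_def)
      then obtain Ls where Ls: "prim (Q (Suc t)) Ls" "Ls \<noteq> []" "hd Ls = B" "last Ls = Z"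
        using less.hyps AB(3) by blast
      have "prim (Q s) (Ks @ Ls)" using prim_append[OF Ks(1,2) Ls(1,2), of A] AB Ls(3) t(2) by simp
      then show ?thesis using Ks Ls by (intro exI[of _ "Ks @ Ls"]) simp
    qed
  qed
  then show thesis using that by blast
qed

subsection \<open>Critical edges\<close>

abbreviation (input) "avoiding S \<equiv> E - {e. edge_label e \<subseteq> S}"

definition zcomp :: "'a set \<Rightarrow> 'a set set" where
  "zcomp S = {L. (Z, L) \<in> (avoiding S)\<^sup>*}"

abbreviation (input) "clique_digraph \<equiv> with_proj \<lparr>pverts = V, parcs = E\<rparr>"

abbreviation (input) "zgraph S \<equiv> component (del_arcs clique_digraph {e. edge_label e \<subseteq> S}) Z"

abbreviation (input) "critical_labels X \<equiv> edge_label ` critical_edges X Z"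

text \<open>In the clique graph, these are the non-simplicial vertices of \<open>Z\<close>, namely
  those that lie in a further maximal clique.\<close>

abbreviation (input) "top_label \<equiv> Z \<inter> \<Union>(V - {Z})"

lemma no_loop: "(A, A) \<notin> E"
  using edge_separates[of A A] by auto

lemma clique_digraph_Q: "clique_digraph = arc_graph (Q 0) (E \<inter> Q 0 \<times> Q 0)"
  using E_subset by (simp add: with_proj_def Q_0 Int_absorb2)

lemma zgraph_eq: "zgraph S = arc_graph (zcomp S) (avoiding S \<inter> zcomp S \<times> zcomp S)"
proof -
  have "del_arcs clique_digraph {e. edge_label e \<subseteq> S} = arc_graph V (avoiding S)"
    by (simp add: del_arcs_def with_proj_def)
  moreover have "avoiding S \<subseteq> V \<times> V" using E_subset by blast
  ultimately show ?thesis
    using component_arc_graph[OF Z_in_V _ sym_edge_label_le[OF sym_E]] by (simp add: zcomp_def)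
qed

lemma upper_subset_avoiding: "\<lbrakk>finite S; card S < s\<rbrakk> \<Longrightarrow> upper s \<subseteq> avoiding S"
  using upper_avoids[of S s] by auto

lemma Q_subset_zcomp: "\<lbrakk>finite S; card S < s\<rbrakk> \<Longrightarrow> Q s \<subseteq> zcomp S"
proof
  fix L assume "finite S" "card S < s" "L \<in> Q s"
  then have "(Z, L) \<in> (upper s)\<^sup>*" "upper s \<subseteq> avoiding S"
    using upper_subset_avoiding by (simp_all add: Q_def)
  then have "(Z, L) \<in> (avoiding S)\<^sup>*" by (rule rtrancl_subsetD)
  then show "L \<in> zcomp S" by (simp add: zcomp_def)
qed

text \<open>Every edge entering \<open>Q (Suc t)\<close> has its label inside \<open>S\<close> and
  is deleted, while edges heavier than \<open>card S = t\<close> survive.\<close>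

lemma zcomp_lev:
  assumes "lev t S"
  shows "zcomp S = Q (Suc t)"
proof
  show "zcomp S \<subseteq> Q (Suc t)"
  proof
    fix L assume "L \<in> zcomp S"
    then have "(Z, L) \<in> (avoiding S)\<^sup>*" by (simp add: zcomp_def)
    then show "L \<in> Q (Suc t)"
    proof (induction rule: rtrancl_induct)
      case base
      show ?case by (rule Z_in_Q)
    next
      case (step X Y)
      then have "(Y, X) \<in> E" "\<not> Y \<inter> X \<subseteq> S" by (auto dest: E_symD)
      then show ?case using lev_crossing_subset[OF assms] step.IH by blast
    qed
  qed
  show "Q (Suc t) \<subseteq> zcomp S"
    using lev_card[OF assms] lev_finite[OF assms] by (intro Q_subset_zcomp) auto
qed

lemma zgraph_lev:
  assumes "lev t S"
  shows "zgraph S = arc_graph (Q (Suc t)) (E \<inter> Q (Suc t) \<times> Q (Suc t))"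
proof -
  have "avoiding S \<inter> Q (Suc t) \<times> Q (Suc t) = E \<inter> Q (Suc t) \<times> Q (Suc t)"
  proof -
    have "\<not> A \<inter> B \<subseteq> S" if "(A, B) \<in> E" "A \<in> Q (Suc t)" "B \<in> Q (Suc t)" for A B
      using inner_weight[OF that(2,3,1)] card_mono[OF lev_finite[OF assms], of "A \<inter> B"]
        lev_card[OF assms] by auto
    then show ?thesis by auto
  qed
  then show ?thesis by (simp add: zgraph_eq zcomp_lev[OF assms])
qed

lemma min_weight_edges_arc_graph:
  assumes "\<And>A B. (A, B) \<in> F \<Longrightarrow> t \<le> card (A \<inter> B)" "(P, P') \<in> F" "card (P \<inter> P') = t"
  shows "min_weight_edges (arc_graph W F) = {(A, B) \<in> F. card (A \<inter> B) = t}"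
proof
  show "min_weight_edges (arc_graph W F) \<subseteq> {(A, B) \<in> F. card (A \<inter> B) = t}"
  proof
    fix e assume e: "e \<in> min_weight_edges (arc_graph W F)"
    obtain A B where AB: "e = (A, B)" by (cases e)
    have "(A, B) \<in> F" using e by (simp add: min_weight_edges_def AB)
    moreover have "card (A \<inter> B) \<le> card (P \<inter> P')"
      using e assms(2) by (auto simp: min_weight_edges_def edge_weight_def AB)
    ultimately show "e \<in> {(A, B) \<in> F. card (A \<inter> B) = t}"
      using assms(1)[of A B] assms(3) by (simp add: AB)
  qed
  show "{(A, B) \<in> F. card (A \<inter> B) = t} \<subseteq> min_weight_edges (arc_graph W F)"
    using assms(1) by (auto simp: min_weight_edges_def edge_weight_def)
qed

lemma component_heavy:
  assumes "Z \<in> W" "F \<subseteq> W \<times> W" "sym F"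
    and "\<And>A B. (A, B) \<in> F \<Longrightarrow> t \<le> card (A \<inter> B)" "(P, P') \<in> F" "card (P \<inter> P') = t"
  shows "verts (component (del_arcs (arc_graph W F) (min_weight_edges (arc_graph W F))) Z) =
    {L. (Z, L) \<in> {(A, B) \<in> F. Suc t \<le> card (A \<inter> B)}\<^sup>*}"
proof -
  have eq: "F - {(A, B) \<in> F. card (A \<inter> B) = t} = {(A, B) \<in> F. Suc t \<le> card (A \<inter> B)}"
    using assms(4) by (auto simp: Suc_le_eq nat_less_le)
  have "{(A, B) \<in> F. Suc t \<le> card (A \<inter> B)} \<subseteq> W \<times> W" "sym {(A, B) \<in> F. Suc t \<le> card (A \<inter> B)}"
    using assms(2,3) by (auto simp: sym_def Int_commute)
  then show ?thesis
    using component_arc_graph[OF assms(1)] min_weight_edges_arc_graph[OF assms(4-6)]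
    by (simp add: del_arcs_def eq)
qed

text \<open>The lightest edges on \<open>Q t\<close> weigh \<open>t\<close>, and deleting them
  leaves \<open>Q (Suc t)\<close> as the component of \<open>Z\<close>. Critical edges are thus the
  edges of weight \<open>t\<close> touching \<open>Q (Suc t)\<close>; by \<open>inner_weight\<close>
  only one end lies there, and reversing an arc keeps its label.\<close>

lemma critical_labels_Q:
  assumes "jump t"
  shows "critical_labels (arc_graph (Q t) (E \<inter> Q t \<times> Q t)) =
    {X \<inter> Y | X Y. (X, Y) \<in> E \<and> X \<in> Q t - Q (Suc t) \<and> Y \<in> Q (Suc t)}"
proof -
  let ?F = "E \<inter> Q t \<times> Q t"
  obtain P P' where P: "(P, P') \<in> E" "P \<in> Q t - Q (Suc t)" "P' \<in> Q (Suc t)"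
    using jump_crossing[OF assms] by metis
  have F: "?F \<subseteq> Q t \<times> Q t" "sym ?F" "\<And>A B. (A, B) \<in> ?F \<Longrightarrow> t \<le> card (A \<inter> B)"
    "(P, P') \<in> ?F" "card (P \<inter> P') = t"
    using P Q_Suc_subset crossing_weight[OF P] E_symD by (auto simp: inner_weight intro!: symI)
  have min_edges: "min_weight_edges (arc_graph (Q t) ?F) = {(A, B) \<in> ?F. card (A \<inter> B) = t}"
    by (rule min_weight_edges_arc_graph) (fact F)+
  have "{L. (Z, L) \<in> {(A, B) \<in> ?F. Suc t \<le> card (A \<inter> B)}\<^sup>*} = Q (Suc t)"
  proof
    show "Q (Suc t) \<subseteq> {L. (Z, L) \<in> {(A, B) \<in> ?F. Suc t \<le> card (A \<inter> B)}\<^sup>*}"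
    proof
      fix L assume "L \<in> Q (Suc t)"
      then have "(Z, L) \<in> (E \<inter> Q (Suc t) \<times> Q (Suc t))\<^sup>*" by (rule Q_inner_path[OF Z_in_Q])
      moreover have "E \<inter> Q (Suc t) \<times> Q (Suc t) \<subseteq> {(A, B) \<in> ?F. Suc t \<le> card (A \<inter> B)}"
        using Q_Suc_subset inner_weight by blast
      ultimately show "L \<in> {L. (Z, L) \<in> {(A, B) \<in> ?F. Suc t \<le> card (A \<inter> B)}\<^sup>*}"
        by (simp add: rtrancl_subsetD)
    qed
    have "{(A, B) \<in> ?F. Suc t \<le> card (A \<inter> B)} \<subseteq> upper (Suc t)" by (auto simp: upper_def)
    then show "{L. (Z, L) \<in> {(A, B) \<in> ?F. Suc t \<le> card (A \<inter> B)}\<^sup>*} \<subseteq> Q (Suc t)"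
      unfolding Q_def by (blast intro: rtrancl_subsetD)
  qed
  then have heavy: "verts (component (del_arcs (arc_graph (Q t) ?F)
      (min_weight_edges (arc_graph (Q t) ?F))) Z) = Q (Suc t)"
    using component_heavy[OF Z_in_Q F] by simp
  have critical: "critical_edges (arc_graph (Q t) ?F) Z =
      {(A, B) \<in> ?F. card (A \<inter> B) = t \<and> (A \<in> Q (Suc t) \<or> B \<in> Q (Suc t))}"
    unfolding critical_edges_def heavy[unfolded min_edges] min_edges by auto
  let ?L = "edge_label ` {(A, B) \<in> ?F. card (A \<inter> B) = t \<and> (A \<in> Q (Suc t) \<or> B \<in> Q (Suc t))}"
    and ?R = "{X \<inter> Y | X Y. (X, Y) \<in> E \<and> X \<in> Q t - Q (Suc t) \<and> Y \<in> Q (Suc t)}"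
  show ?thesis
    unfolding critical
  proof
    show "?L \<subseteq> ?R"
    proof
      fix S assume "S \<in> ?L"
      then obtain e where e: "S = edge_label e"
        "e \<in> {(A, B) \<in> ?F. card (A \<inter> B) = t \<and> (A \<in> Q (Suc t) \<or> B \<in> Q (Suc t))}" by blast
      obtain A B where "e = (A, B)" by (cases e)
      then have AB: "S = A \<inter> B" "(A, B) \<in> E" "A \<in> Q t" "B \<in> Q t" "card (A \<inter> B) = t"
        "A \<in> Q (Suc t) \<or> B \<in> Q (Suc t)" using e by simp_all
      have "\<not> (A \<in> Q (Suc t) \<and> B \<in> Q (Suc t))" using inner_weight[of A "Suc t" B] AB by auto
      then consider "A \<in> Q (Suc t)" "B \<notin> Q (Suc t)" | "A \<notin> Q (Suc t)" "B \<in> Q (Suc t)"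
        using AB by blast
      then show "S \<in> ?R"
      proof cases
        case 1
        then have "S = B \<inter> A \<and> (B, A) \<in> E \<and> B \<in> Q t - Q (Suc t) \<and> A \<in> Q (Suc t)"
          using AB E_symD by auto
        then show ?thesis by blast
      next
        case 2
        then show ?thesis using AB by blast
      qed
    qed
    show "?R \<subseteq> ?L"
    proof
      fix S assume "S \<in> ?R"
      then obtain X Y where XY: "S = X \<inter> Y" "(X, Y) \<in> E" "X \<in> Q t - Q (Suc t)" "Y \<in> Q (Suc t)"
        by blast
      then have "(X, Y) \<in> {(A, B) \<in> ?F. card (A \<inter> B) = t \<and> (A \<in> Q (Suc t) \<or> B \<in> Q (Suc t))}"
        using crossing_weight[of X Y t] Q_Suc_subset by auto
      then show "S \<in> ?L" using XY(1) by (intro image_eqI[of _ _ "(X, Y)"]) auto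
    qed
  qed
qed

lemma critical_labels_lev:
  assumes "lev t S"
  shows "critical_labels (arc_graph (Q t) (E \<inter> Q t \<times> Q t)) = {S}"
proof -
  obtain X Y where "(X, Y) \<in> E" "X \<in> Q t - Q (Suc t)" "Y \<in> Q (Suc t)" "X \<inter> Y = S"
    using assms by (auto simp: lev_def)
  moreover define M where
    "M = {X \<inter> Y | X Y. (X, Y) \<in> E \<and> X \<in> Q t - Q (Suc t) \<and> Y \<in> Q (Suc t)}"
  ultimately have "S \<in> M" unfolding M_def by (intro CollectI exI conjI) simp_all
  moreover have "L = S" if L: "L \<in> M" for L
  proof -
    obtain X Y where "L = X \<inter> Y" "(X, Y) \<in> E" "X \<in> Q t - Q (Suc t)" "Y \<in> Q (Suc t)"
      using L unfolding M_def by blast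
    then show ?thesis using lev_crossing[OF assms, of X Y] by simp
  qed
  ultimately have "M = {S}" by blast
  then show ?thesis unfolding critical_labels_Q[OF lev_jump[OF assms]] M_def .
qed

lemma critical_labels_no_arcs: "critical_labels (arc_graph W {}) = {}"
  by (simp add: critical_edges_def min_weight_edges_def)

subsection \<open>From levels to critical sequences\<close>

text \<open>One edge per level, from threshold \<open>s\<close> upward until only \<open>Z\<close>
  remains. The index \<open>t\<close> may exceed \<open>s\<close> because thresholds without a jump
  are skipped.\<close>

inductive chain :: "nat \<Rightarrow> ('a set \<times> 'a set) list \<Rightarrow> bool" where
  chain_Nil: "Q s = {Z} \<Longrightarrow> chain s []"
| chain_Cons: "\<lbrakk>Q t = Q s; lev t (edge_label e); chain (Suc t) es\<rbrakk> \<Longrightarrow> chain s (e # es)"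

lemma chain_hd:
  assumes "chain s es" "es \<noteq> []"
  shows "critical_labels (arc_graph (Q s) (E \<inter> Q s \<times> Q s)) = {edge_label (hd es)}"
  using assms(1)
proof cases
  case chain_Nil
  then show ?thesis using assms(2) by simp
next
  case (chain_Cons t e es')
  then show ?thesis using critical_labels_lev[OF chain_Cons(3)] by simp
qed

lemma chain_nth:
  "\<lbrakk>chain s es; Suc i < length es\<rbrakk> \<Longrightarrow>
    critical_labels (zgraph (edge_label (es ! i))) = {edge_label (es ! Suc i)}"
proof (induction arbitrary: i rule: chain.induct)
  case (chain_Cons t s e es)
  show ?case
  proof (cases i)
    case 0
    then show ?thesis
      using chain_Cons.prems chain_hd[OF chain_Cons.hyps(3)] zgraph_lev[OF chain_Cons.hyps(2)]
      by (cases es) auto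
  next
    case (Suc j)
    then show ?thesis using chain_Cons by simp
  qed
qed simp

text \<open>The path from \<open>path_superset_labels\<close> has an edge that arrives at
  \<open>Z\<close>, and its label contains all of \<open>X \<inter> Z\<close>.\<close>

lemma path_edge_into_Z:
  assumes "X \<in> V" "X \<noteq> Z"
  obtains W where "(W, Z) \<in> E" "W \<noteq> Z" "X \<inter> Z \<subseteq> W \<inter> Z"
proof -
  have ends: "X \<in> - {Z}" "Z \<notin> - {Z}" using assms(2) by auto
  obtain W W' where "(W, W') \<in> {(A, B) \<in> E. X \<inter> Z \<subseteq> A \<inter> B}" "W \<in> - {Z}" "W' \<notin> - {Z}"
    by (rule rtrancl_exit_edge[OF path_superset_labels[OF assms(1) Z_in_V] ends])
  then show thesis using that[of W] by auto
qed

lemma lev_top_label: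
  assumes "lev t S" "Q (Suc t) = {Z}"
  shows "S = top_label"
proof
  show "S \<subseteq> top_label" using assms Q_subset_V[of t] by (auto simp: lev_def)
  show "top_label \<subseteq> S"
  proof
    fix v assume "v \<in> top_label"
    then obtain X where "X \<in> V" "X \<noteq> Z" "v \<in> X" "v \<in> Z" by blast
    then obtain W where "(W, Z) \<in> E" "W \<noteq> Z" "X \<inter> Z \<subseteq> W \<inter> Z"
      using path_edge_into_Z[of X] by blast
    moreover have "W \<inter> Z \<subseteq> S"
      using calculation lev_crossing_subset[OF assms(1), of W Z] assms(2) by simp
    ultimately show "v \<in> S" using \<open>v \<in> X\<close> \<open>v \<in> Z\<close> by blast
  qed
qed

lemma chain_last: "\<lbrakk>chain s es; es \<noteq> []\<rbrakk> \<Longrightarrow> edge_label (last es) = top_label"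
proof (induction rule: chain.induct)
  case (chain_Cons t s e es)
  show ?case
  proof (cases "es = []")
    case True
    then have "Q (Suc t) = {Z}" using chain_Cons.hyps(3) by (auto elim: chain.cases)
    then show ?thesis using True lev_top_label[OF chain_Cons.hyps(2)] by simp
  next
    case False
    then show ?thesis using chain_Cons.IH by simp
  qed
qed simp

text \<open>The path is taken in the digraph induced on \<open>W\<close>, which confines its
  vertices, and is then transferred to the whole digraph.\<close>

lemma apath_induced:
  assumes "(A, B) \<in> (E \<inter> W \<times> W)\<^sup>*" "A \<in> W" "W \<subseteq> V"
  obtains p where "pre_digraph.apath clique_digraph A p B" "set (pawalk_verts A p) \<subseteq> W"
proof -
  let ?H = "\<lparr>pverts = W, parcs = E \<inter> W \<times> W\<rparr>" and ?C = "\<lparr>pverts = V, parcs = E\<rparr>"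
  interpret H: pair_wf_digraph ?H by unfold_locales auto
  interpret C: pair_wf_digraph ?C using E_subset by unfold_locales auto
  have "A \<rightarrow>\<^sup>*\<^bsub>with_proj ?H\<^esub> B" using assms(1,2) by (simp add: H.reachable_conv')
  then obtain p where p: "H.apath A p B" by (auto simp: H.reachable_apath)
  have "set (pawalk_verts A p) \<subseteq> W" using p by (auto simp: H.apath_def elim!: H.awalkE')
  moreover have "subgraph (with_proj ?H) (with_proj ?C)"
    using assms(3) H.wf_digraph_axioms C.wf_digraph_axioms by (auto intro!: subgraphI)
  then have "pre_digraph.apath (with_proj ?C) A p B"
    using C.subgraph_apath_imp_apath p by blast
  ultimately show thesis using that by blast
qed

text \<open>Each layer is crossed by a path within it, followed by the entry edge and a recursive
  path from its end. The layers are disjoint, so no clique is visited twice; the entry edges form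
  the sequence.\<close>

lemma levels_chain:
  assumes levels "start s K"
  shows "\<exists>p es. pre_digraph.apath clique_digraph K p Z \<and> set (pawalk_verts K p) \<subseteq> Q s \<and>
    subseq es p \<and> chain s es"
  using assms(2)
proof (induction "card (Q s)" arbitrary: s K rule: less_induct)
  case less
  let ?C = "\<lparr>pverts = V, parcs = E\<rparr>"
  interpret C: pair_wf_digraph ?C using E_subset by unfold_locales auto
  show ?case
  proof (cases "Q s = {Z}")
    case True
    then have "K = Z" using less.prems by (simp add: start_def)
    then have "C.apath K [] Z" using Z_in_V by (simp add: C.apath_Nil_iff)
    then show ?thesis using True \<open>K = Z\<close> chain_Nil
      by (intro exI[of _ "[]"]) (auto simp: start_def)
  next
    case False
    then obtain t where t: "jump t" "Q t = Q s" using next_jump by metis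
    obtain S where S: "lev t S" using assms(1) t(1) by (auto simp: levels_def)
    have K: "K \<in> Q t - Q (Suc t)" using less.prems start_first_jump[OF t] by simp
    obtain A B where AB: "(A, B) \<in> E" "A \<in> Q t - Q (Suc t)" "start (Suc t) B" "A \<inter> B = S"
      using entry_edge[OF assms(1) S] by metis
    have "card (Q (Suc t)) < card (Q s)"
      using t Q_Suc_subset[of t] finite_Q by (intro psubset_card_mono) (auto simp: jump_def)
    then obtain p es where p: "C.apath B p Z" "set (pawalk_verts B p) \<subseteq> Q (Suc t)"
      and es: "subseq es p" "chain (Suc t) es"
      using less.hyps AB(3) by blast
    obtain q where q: "C.apath K q A" "set (pawalk_verts K q) \<subseteq> Q t - Q (Suc t)"
      using apath_induced[OF layer_connected[OF S K AB(2)] K] Q_subset_V by blast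
    have last: "last (pawalk_verts K q) = A"
      using q(1) C.awlast_of_awalk by (auto simp: C.apath_def)
    have "C.apath K (q @ (A, B) # p) Z"
      unfolding C.apath_append_iff last C.apath_Cons_iff using q p AB(1,2) by auto
    moreover have "set (pawalk_verts K (q @ (A, B) # p)) = set (pawalk_verts K q) \<union> set (pawalk_verts A ((A, B) # p))"
      using calculation C.set_awalk_verts_append[of K q A "(A, B) # p" Z] q(1) last
      by (auto simp: C.apath_def)
    then have "set (pawalk_verts K (q @ (A, B) # p)) \<subseteq> Q s"
      using q(2) p(2) AB(2) t(2) Q_Suc_subset[of t] by auto
    moreover have "subseq ((A, B) # es) (q @ (A, B) # p)"
      using es(1) by (intro list_emb_append2) auto
    moreover have "chain s ((A, B) # es)"
      using t(2) S AB(4) es(2) by (intro chain_Cons) auto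
    ultimately show ?thesis by blast
  qed
qed

subsection \<open>From critical sequences to levels\<close>

lemma finite_top_label: "finite top_label"
  using finite_members[OF Z_in_V] by simp

lemma label_at_Z: "(X, Z) \<in> E \<Longrightarrow> X \<inter> Z \<subseteq> top_label"
proof -
  assume "(X, Z) \<in> E"
  then have "X \<in> V - {Z}" using E_D(1) no_loop by auto
  then show ?thesis by blast
qed

text \<open>All labels at \<open>Z\<close> lie in the top label, so deleting them isolates
  \<open>Z\<close>. Hence no critical label can follow the top label.\<close>

lemma zgraph_top_label: "zgraph top_label = arc_graph {Z} {}"
proof -
  have "zcomp top_label = {Z}"
  proof
    show "zcomp top_label \<subseteq> {Z}"
    proof
      fix L assume "L \<in> zcomp top_label"
      then have "(Z, L) \<in> (avoiding top_label)\<^sup>*" by (simp add: zcomp_def)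
      then show "L \<in> {Z}"
      proof (cases rule: converse_rtranclE)
        case (step X)
        then have "(X, Z) \<in> E" "\<not> X \<inter> Z \<subseteq> top_label" by (auto simp: Int_commute dest: E_symD)
        then show ?thesis using label_at_Z by blast
      qed simp
    qed
  qed (simp add: zcomp_def)
  then show ?thesis unfolding zgraph_eq using no_loop by auto
qed

lemma Q_above_top_label:
  assumes "card top_label < s"
  shows "Q s = {Z}"
proof -
  have "finite top_label" by (rule finite_top_label)
  then have "Q s \<subseteq> zcomp top_label" using assms by (rule Q_subset_zcomp)
  also have "\<dots> = {Z}" using zgraph_top_label unfolding zgraph_eq by simp
  finally show ?thesis using Z_in_Q by blast
qed

text \<open>If the \<open>z\<close>-component at a label \<open>S\<close> leaks out of the layer below \<open>Q (Suc t)\<close>, its critical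
  edges repeat a label that occurred earlier.\<close>

lemma leak_repeats:
  assumes cross: "\<And>X Y. \<lbrakk>(X, Y) \<in> E; X \<in> Q t - Q (Suc t); Y \<in> Q (Suc t)\<rbrakk> \<Longrightarrow> X \<inter> Y = S"
    and leak: "(X, Y) \<in> E" "X \<notin> Q (Suc t)" "Y \<in> Q (Suc t)" "\<not> X \<inter> Y \<subseteq> S"
    and S: "finite S" "card S = t"
    and critical: "critical_labels (zgraph S) = {S'}"
  obtains r where "r < t" "jump r" "\<And>R. lev r R \<Longrightarrow> S' = R"
proof -
  define C where "C = zcomp S"
  define F where "F = avoiding S \<inter> C \<times> C"
  have "Y \<in> C" using leak(3) Q_subset_zcomp[OF S(1)] S(2) by (auto simp: C_def)
  moreover have "(Y, X) \<in> avoiding S" using leak by (auto simp: Int_commute dest: E_symD)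
  ultimately have XC: "X \<in> C"
    unfolding C_def zcomp_def by (metis mem_Collect_eq rtrancl.rtrancl_into_rtrancl)
  have path: "(Z, L) \<in> F\<^sup>*" if "L \<in> C" for L
  proof -
    have "(Z, L) \<in> (avoiding S)\<^sup>*" using that by (simp add: C_def zcomp_def)
    then have "L \<in> C \<and> (Z, L) \<in> F\<^sup>*"
    proof (induction rule: rtrancl_induct)
      case base
      then show ?case by (simp add: C_def zcomp_def)
    next
      case (step A B)
      then have "B \<in> C" unfolding C_def zcomp_def by (metis mem_Collect_eq rtrancl.rtrancl_into_rtrancl)
      then have "(A, B) \<in> F" using step by (simp add: F_def)
      then show ?case using step.IH \<open>B \<in> C\<close> by (metis rtrancl.rtrancl_into_rtrancl)
    qed
    then show ?thesis ..
  qed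
  \<comment> \<open>The component \<open>C\<close> fits into \<open>Q r\<close> but not into
    \<open>Q (Suc r)\<close>.\<close>
  define r where "r = (LEAST r. \<not> C \<subseteq> Q (Suc r))"
  have notC: "\<not> C \<subseteq> Q (Suc t)" using XC leak(2) by blast
  have r: "\<not> C \<subseteq> Q (Suc r)" unfolding r_def by (rule LeastI[of _ t]) (rule notC)
  have rt: "r \<le> t" unfolding r_def by (rule Least_le) (rule notC)
  have Cr: "C \<subseteq> Q r"
  proof (cases r)
    case 0
    have "C \<subseteq> V"
    proof
      fix L assume "L \<in> C"
      then have "(Z, L) \<in> (avoiding S)\<^sup>*" by (simp add: C_def zcomp_def)
      then show "L \<in> V" by (cases rule: rtranclE) (use Z_in_V E_D in auto)
    qed
    then show ?thesis by (simp add: 0 Q_0)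
  next
    case (Suc r')
    then have "r' < (LEAST r. \<not> C \<subseteq> Q (Suc r))" by (simp add: r_def)
    then show ?thesis using not_less_Least Suc by blast
  qed
  \<comment> \<open>At \<open>t\<close> itself, every crossing edge inside \<open>Q t\<close> has
    label \<open>S\<close> and has been deleted.\<close>
  have "r \<noteq> t"
  proof
    assume "r = t"
    obtain P P' where "(P, P') \<in> F" "P \<in> Q (Suc t)" "P' \<notin> Q (Suc t)"
      by (rule rtrancl_exit_edge[OF path[OF XC] Z_in_Q leak(2)])
    then have P: "(P', P) \<in> E" "P' \<in> Q t - Q (Suc t)" "P \<in> Q (Suc t)" "\<not> P' \<inter> P \<subseteq> S"
      using Cr \<open>r = t\<close> E_symD[of P P'] by (auto simp: F_def)
    then show False using cross[OF P(1-3)] by simp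
  qed
  then have rt: "r < t" using rt by simp
  obtain W where W: "W \<in> C" "W \<notin> Q (Suc r)" using r by blast
  have jump: "jump r" using W Cr by (auto simp: jump_def)
  have F: "F \<subseteq> C \<times> C" "sym F"
  proof -
    have "(B, A) \<in> F" if "(A, B) \<in> F" for A B
      using that E_symD[of A B] by (simp add: F_def Int_commute)
    then show "sym F" by (rule symI)
  qed (simp add: F_def)
  have Fr: "r \<le> card (A \<inter> B)" if "(A, B) \<in> F" for A B
    using that Cr by (intro inner_weight) (auto simp: F_def)
  have light: "card (A \<inter> B) = r" if "(A, B) \<in> F" "A \<in> Q (Suc r)" "B \<notin> Q (Suc r)" for A B
  proof -
    have "card (B \<inter> A) = r" using that Cr E_symD by (intro crossing_weight) (auto simp: F_def)
    then show ?thesis by (simp add: Int_commute)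
  qed
  have ZC: "Z \<in> C" by (simp add: C_def zcomp_def)
  obtain P P' where P: "(P, P') \<in> F" "P \<in> Q (Suc r)" "P' \<notin> Q (Suc r)"
    by (rule rtrancl_exit_edge[OF path[OF W(1)] Z_in_Q W(2)])
  \<comment> \<open>The component of \<open>Z\<close> in \<open>C\<close> without the edges of
    weight \<open>r\<close>, the least weight in \<open>C\<close>. An edge leaving it is critical
    and crosses level \<open>r\<close>.\<close>
  let ?D = "{L. (Z, L) \<in> {(A, B) \<in> F. Suc r \<le> card (A \<inter> B)}\<^sup>*}"
  have "{(A, B) \<in> F. Suc r \<le> card (A \<inter> B)} \<subseteq> upper (Suc r)" by (auto simp: F_def upper_def)
  then have DQ: "?D \<subseteq> Q (Suc r)" unfolding Q_def by (blast intro: rtrancl_subsetD)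
  then have notD: "W \<notin> ?D" using W by blast
  have ZD: "Z \<in> ?D" by simp
  obtain A B where AB: "(A, B) \<in> F" "A \<in> ?D" "B \<notin> ?D"
    by (rule rtrancl_exit_edge[OF path[OF W(1)] ZD notD])
  have "\<not> Suc r \<le> card (A \<inter> B)"
  proof
    assume "Suc r \<le> card (A \<inter> B)"
    then have "(A, B) \<in> {(A, B) \<in> F. Suc r \<le> card (A \<inter> B)}" using AB by simp
    then show False using AB(2,3) by (metis (no_types, lifting) mem_Collect_eq rtrancl.rtrancl_into_rtrancl)
  qed
  then have weight: "card (A \<inter> B) = r" using Fr[OF AB(1)] by simp
  have "(A, B) \<in> critical_edges (arc_graph C F) Z"
    using min_weight_edges_arc_graph[where F = F and W = C and t = r, OF Fr P(1) light[OF P]]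
      component_heavy[where F = F and t = r, OF ZC F Fr P(1) light[OF P]] AB weight
    by (simp add: critical_edges_def)
  then have "A \<inter> B \<in> critical_labels (zgraph S)"
    unfolding zgraph_eq C_def[symmetric] F_def[symmetric] by (intro image_eqI[of _ _ "(A, B)"]) auto
  then have "A \<inter> B = S'" using critical by simp
  moreover have "B \<inter> A = R" if "lev r R" for R
  proof (rule lev_crossing[OF that])
    show "(B, A) \<in> E" "A \<in> Q (Suc r)" using AB DQ E_symD by (auto simp: F_def)
    have "B \<notin> Q (Suc r)"
      using inner_weight[of A "Suc r" B] \<open>A \<in> Q (Suc r)\<close> weight AB(1) by (auto simp: F_def)
    then show "B \<in> Q r - Q (Suc r)" using AB(1) Cr by (auto simp: F_def)
  qed
  ultimately show thesis using that[OF rt jump] by (metis Int_commute)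
qed

lemma critical_nonempty_not_Z:
  assumes "critical_labels (arc_graph (Q s) (E \<inter> Q s \<times> Q s)) \<noteq> {}"
  shows "Q s \<noteq> {Z}"
proof
  assume "Q s = {Z}"
  moreover have "E \<inter> {Z} \<times> {Z} = {}" using no_loop by blast
  ultimately show False using assms critical_labels_no_arcs by metis
qed

text \<open>The z-component at a level label is the component above that level, so the next label
  belongs to the next jump. The critical edges control only the crossing edges from the layer; a
  lighter label that leaks is refuted through the final label. Accounting for all lower jumps in the
  statement is what turns a leak into a repetition.\<close>

lemma critical_levels_aux:
  assumes hd: "critical_labels clique_digraph = {S 0}"
    and last: "S k = top_label"
    and step: "\<And>i. i < k \<Longrightarrow> critical_labels (zgraph (S i)) = {S (Suc i)}"
    and "n \<le> k"
  shows "\<exists>t. lev t (S n) \<and> (\<forall>t'<t. jump t' \<longrightarrow> (\<exists>m<n. lev t' (S m)))"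
  using assms(4)
proof (induction n rule: less_induct)
  case (less n)
  obtain s where s: "critical_labels (arc_graph (Q s) (E \<inter> Q s \<times> Q s)) = {S n}"
    and below: "\<forall>t'<s. jump t' \<longrightarrow> (\<exists>m<n. lev t' (S m))"
  proof (cases n)
    case 0
    then show thesis using that[of 0] hd clique_digraph_Q by simp
  next
    case (Suc n')
    then obtain t where t: "lev t (S n')" "\<forall>t'<t. jump t' \<longrightarrow> (\<exists>m<n'. lev t' (S m))"
      using less.IH[of n'] less.prems by auto
    show thesis
    proof (rule that)
      show "critical_labels (arc_graph (Q (Suc t)) (E \<inter> Q (Suc t) \<times> Q (Suc t))) = {S n}"
        using step[of n'] zgraph_lev[OF t(1)] Suc less.prems by simp
      show "\<forall>t'<Suc t. jump t' \<longrightarrow> (\<exists>m<n. lev t' (S m))"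
        using t Suc by (metis less_Suc_eq)
    qed
  qed
  obtain t where t: "s \<le> t" "jump t" "Q t = Q s" "\<And>u. \<lbrakk>s \<le> u; u < t\<rbrakk> \<Longrightarrow> \<not> jump u"
    using next_jump critical_nonempty_not_Z[of s] s by (metis insert_not_empty)
  have below: "\<exists>m<n. lev t' (S m)" if "t' < t" "jump t'" for t'
    using below t(4)[of t'] that by (cases "s \<le> t'") auto
  have labels: "{X \<inter> Y | X Y. (X, Y) \<in> E \<and> X \<in> Q t - Q (Suc t) \<and> Y \<in> Q (Suc t)} = {S n}"
    using s critical_labels_Q[OF t(2)] t(3) by simp
  have cross: "X \<inter> Y = S n" if "(X, Y) \<in> E" "X \<in> Q t - Q (Suc t)" "Y \<in> Q (Suc t)" for X Y
  proof -
    have "X \<inter> Y \<in> {X \<inter> Y | X Y. (X, Y) \<in> E \<and> X \<in> Q t - Q (Suc t) \<and> Y \<in> Q (Suc t)}"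
      using that by blast
    then show ?thesis unfolding labels by simp
  qed
  obtain X0 Y0 where XY0: "(X0, Y0) \<in> E" "X0 \<in> Q t - Q (Suc t)" "Y0 \<in> Q (Suc t)" "X0 \<inter> Y0 = S n"
    using jump_crossing[OF t(2)] cross by metis
  have S: "finite (S n)" "card (S n) = t"
    using XY0 crossing_weight[of X0 Y0 t] finite_label by metis+
  have "X \<inter> Y \<subseteq> S n" if XY: "(X, Y) \<in> E" "X \<notin> Q (Suc t)" "Y \<in> Q (Suc t)" for X Y
  proof (cases "n = k")
    case True
    then have "Q (Suc t) = {Z}" using S(2) last by (intro Q_above_top_label) simp
    then show ?thesis using XY label_at_Z True last by auto
  next
    case False
    then have n: "n < k" using less.prems by simp
    show ?thesis
    proof (rule ccontr)
      assume leak: "\<not> X \<inter> Y \<subseteq> S n"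
      obtain r where r: "r < t" "jump r" "\<And>R. lev r R \<Longrightarrow> S (Suc n) = R"
        by (rule leak_repeats[OF cross XY leak S step[OF n]]) blast+
      obtain m where m: "m < n" "S (Suc n) = S m" using below r by metis
      \<comment> \<open>A label determines the critical label after it, so after the repetition no
        new label can appear.\<close>
      have "\<exists>m\<le>n. S j = S m" if "j \<le> k" for j
        using that
      proof (induction j)
        case (Suc j)
        then obtain i where i: "i \<le> n" "S j = S i" by auto
        have "S (Suc j) = S (Suc i)" using step[of j] step[of i] i n Suc.prems by simp
        then show ?case using i m by (cases "i = n") (auto intro: exI[of _ "Suc i"] exI[of _ m])
      qed auto
      then obtain i where i: "i \<le> n" "S k = S i" by auto
      \<comment> \<open>Since \<open>i < k\<close>, the top label would need a successor.\<close>
      then have "critical_labels (zgraph top_label) \<noteq> {}" using step[of i] n last by simp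
      then show False unfolding zgraph_top_label critical_labels_no_arcs by simp
    qed
  qed
  then have "lev t (S n)" unfolding lev_def using XY0 by blast
  then show ?case using below by blast
qed

text \<open>Above the level of the last label only \<open>{Z}\<close> remains, so the sequence
  exhausts all jumps. The first label belongs to the first jump, so the cliques outside its
  z-component form the first layer.\<close>

lemma critical_levels:
  assumes hd: "critical_labels clique_digraph = {S 0}"
    and last: "S k = top_label"
    and step: "\<And>i. i < k \<Longrightarrow> critical_labels (zgraph (S i)) = {S (Suc i)}"
  shows levels "K \<in> V \<Longrightarrow> K \<notin> verts (zgraph (S 0)) \<Longrightarrow> start 0 K"
proof -
  note aux = critical_levels_aux[where S = S, OF assms]
  obtain t where t: "lev t (S k)" "\<forall>t'<t. jump t' \<longrightarrow> (\<exists>m<k. lev t' (S m))"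
    using aux[of k] by auto
  have "Q (Suc t) = {Z}"
    using lev_card[OF t(1)] last by (intro Q_above_top_label) simp
  then have "\<not> jump t'" if "t < t'" for t'
    using that Q_antimono[of "Suc t" t'] Q_antimono[of "Suc t" "Suc t'"] Z_in_Q[of t'] Z_in_Q[of "Suc t'"]
    by (auto simp: jump_def)
  then show levels unfolding levels_def using t by (metis linorder_neqE_nat)
  assume K: "K \<in> V" "K \<notin> verts (zgraph (S 0))"
  obtain t0 where t0: "lev t0 (S 0)" "\<forall>t'<t0. \<not> jump t'" using aux[of 0] by auto
  have "Q t0 = Q 0" using t0(2) by (intro Q_eq_no_jump) auto
  then show "start 0 K"
    using start_first_jump[OF lev_jump[OF t0(1)]] K Q_0 zgraph_lev[OF t0(1)] by simp
qed

end

section \<open>Clique graphs of chordal graphs\<close>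

text \<open>On a walk of least length, a repeated vertex or a forward chord would give a
  shortcut.\<close>

lemma shortest_path:
  assumes "(x, y) \<in> r\<^sup>*"
  shows "\<exists>(p :: nat \<Rightarrow> 'a) m. p 0 = x \<and> p m = y \<and> (\<forall>i<m. (p i, p (Suc i)) \<in> r) \<and>
    (\<forall>j\<le>m. \<forall>i<j. p i \<noteq> p j \<and> ((p i, p j) \<in> r \<longrightarrow> j = Suc i))"
proof -
  define m where "m = (LEAST m. (x, y) \<in> r ^^ m)"
  have "\<exists>m. (x, y) \<in> r ^^ m" using assms by (simp add: rtrancl_power)
  then have m: "(x, y) \<in> r ^^ m" unfolding m_def by (rule LeastI_ex)
  have m_min: "m \<le> n" if "(x, y) \<in> r ^^ n" for n using that unfolding m_def by (rule Least_le)
  obtain p where p: "p 0 = x" "p m = y" "\<And>i. i < m \<Longrightarrow> (p i, p (Suc i)) \<in> r"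
    using m unfolding relpow_fun_conv by blast
  have seg: "(p i, p (i + n)) \<in> r ^^ n" if "i + n \<le> m" for i n
    unfolding relpow_fun_conv using that p(3) by (intro exI[of _ "\<lambda>k. p (i + k)"]) auto
  have start: "(x, p i) \<in> r ^^ i" if "i \<le> m" for i using seg[of 0 i] that p(1) by simp
  have finish: "(p j, y) \<in> r ^^ (m - j)" if "j \<le> m" for j using seg[of j "m - j"] that p(2) by simp
  have "p i \<noteq> p j \<and> ((p i, p j) \<in> r \<longrightarrow> j = Suc i)" if ij: "i < j" "j \<le> m" for i j
  proof (intro conjI notI impI)
    show False if "p i = p j"
    proof -
      have "(x, y) \<in> r ^^ i O r ^^ (m - j)"
        using start[of i] finish[of j] ij that by (auto intro: relcompI)
      then have "(x, y) \<in> r ^^ (i + (m - j))" by (simp only: relpow_add)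
      then show False using m_min ij by fastforce
    qed
    assume "(p i, p j) \<in> r"
    then have "(x, p j) \<in> r ^^ Suc i" using start[of i] ij by (intro relpow_Suc_I) auto
    then have "(x, y) \<in> r ^^ Suc i O r ^^ (m - j)" using finish[of j] ij by blast
    then have "(x, y) \<in> r ^^ (Suc i + (m - j))" by (simp only: relpow_add)
    then show "j = Suc i" using m_min[of "Suc i + (m - j)"] ij by linarith
  qed
  then show ?thesis using p by blast
qed

lemma pcas_path_append:
  "i \<le> j \<Longrightarrow> pcas (p i) (map (\<lambda>k. (p k, p (Suc k))) [i..<j] @ q) v = pcas (p j) q v"
  by (induction i rule: inc_induct) (simp_all add: upt_conv_Cons)

context pair_graph
begin

section \<open>Maximal cliques and separators\<close>

lemma is_clique_iff: "is_clique G K \<longleftrightarrow> K \<subseteq> pverts G \<and> (\<forall>u\<in>K. \<forall>v\<in>K. u \<noteq> v \<longrightarrow> (u, v) \<in> parcs G)"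
  by (simp add: is_clique_def)

lemma clique_adj: "\<lbrakk>is_clique G K; u \<in> K; v \<in> K; u \<noteq> v\<rbrakk> \<Longrightarrow> (u, v) \<in> parcs G"
  by (simp add: is_clique_iff)

lemma maximal_cliqueD: "maximal_clique G K \<Longrightarrow> is_clique G K"
  by (simp add: maximal_clique_def)

lemma maximal_clique_eqI: "\<lbrakk>maximal_clique G K; is_clique G L; K \<subseteq> L\<rbrakk> \<Longrightarrow> L = K"
  by (simp add: maximal_clique_def)

lemma maximal_clique_subset: "maximal_clique G K \<Longrightarrow> K \<subseteq> pverts G"
  by (simp add: maximal_clique_def is_clique_iff)

lemma clique_extend:
  assumes "is_clique G K"
  obtains L where "maximal_clique G L" "K \<subseteq> L"
proof -
  have "finite {L. is_clique G L}"
    by (rule finite_subset[of _ "Pow (pverts G)"]) (auto simp: is_clique_iff pair_finite_verts)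
  then obtain L where L: "is_clique G L" "K \<subseteq> L" "\<forall>M\<in>{L. is_clique G L}. L \<subseteq> M \<longrightarrow> L = M"
    using finite_has_maximal2[of "{L. is_clique G L}" K] assms by auto
  then have "maximal_clique G L" by (auto simp: maximal_clique_def)
  then show thesis using L(2) by (rule that)
qed

definition avoid :: "'a set \<Rightarrow> ('a \<times> 'a) set" where
  "avoid S = parcs G \<inter> (pverts G - S) \<times> (pverts G - S)"

lemma sym_avoid: "sym (avoid S)"
  by (rule symI) (simp add: avoid_def arcs_symmetric)

lemma clique_avoid: "\<lbrakk>is_clique G K; u \<in> K; v \<in> K; u \<notin> S; v \<notin> S\<rbrakk> \<Longrightarrow> (u, v) \<in> (avoid S)\<^sup>*"
  by (cases "u = v") (auto simp: avoid_def is_clique_iff intro!: r_into_rtrancl)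

lemma separator_iff:
  "separator G x y S \<longleftrightarrow> S \<subseteq> pverts G \<and> x \<in> pverts G - S \<and> y \<in> pverts G - S \<and> (x, y) \<notin> (avoid S)\<^sup>*"
proof -
  let ?H = "with_proj G \<restriction> (pverts G - S)"
  interpret H: wf_digraph ?H by unfold_locales auto
  have "arcs_ends ?H = avoid S" by (auto simp: arcs_ends_conv avoid_def)
  then show ?thesis unfolding separator_def using H.reachable_conv'[of x y] by auto
qed

lemma separator_sym: "separator G x y S \<longleftrightarrow> separator G y x S"
  unfolding separator_iff using sym_rtrancl[OF sym_avoid, of S] by (auto dest: symD)

lemma clique_graph_parcs: "(K, L) \<in> parcs (clique_graph G) \<longleftrightarrow>
    maximal_clique G K \<and> maximal_clique G L \<and> K \<noteq> L \<and>
    (\<forall>x\<in>K - L. \<forall>y\<in>L - K. minimal_separator G x y (K \<inter> L))"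
  by (simp add: clique_graph_def)

lemma clique_graph_eq:
  "clique_graph G = \<lparr>pverts = {K. maximal_clique G K}, parcs = parcs (clique_graph G)\<rparr>"
  by (simp add: clique_graph_def)

lemma sym_clique_graph: "sym (parcs (clique_graph G))"
proof (rule symI)
  fix K L assume "(K, L) \<in> parcs (clique_graph G)"
  then show "(L, K) \<in> parcs (clique_graph G)"
    unfolding clique_graph_parcs minimal_separator_def
    by (metis Int_commute separator_sym)
qed

lemma maximal_clique_diff:
  assumes "maximal_clique G K" "maximal_clique G L" "K \<noteq> L"
  obtains x where "x \<in> K" "x \<notin> L"
  using maximal_clique_eqI[OF assms(1) maximal_cliqueD[OF assms(2)]] assms(3) by blast

text \<open>Consecutive cliques on such a path share a vertex outside \<open>K \<inter> L\<close>.
  So all their vertices outside \<open>K \<inter> L\<close> stay connected to \<open>x\<close> in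
  the graph without it, although \<open>K \<inter> L\<close> separates \<open>x\<close> from
  \<open>y\<close>.\<close>

lemma clique_edge_separates:
  assumes KL: "(K, L) \<in> parcs (clique_graph G)"
  shows "(K, L) \<notin> {(X, Y) \<in> parcs (clique_graph G). \<not> X \<inter> Y \<subseteq> K \<inter> L}\<^sup>*"
proof
  have max: "maximal_clique G K" "maximal_clique G L" "K \<noteq> L" using KL by (simp_all add: clique_graph_parcs)
  obtain x where x: "x \<in> K" "x \<notin> L" using maximal_clique_diff[OF max] .
  obtain y where y: "y \<in> L" "y \<notin> K" using maximal_clique_diff[OF max(2,1)] max(3) by metis
  have "minimal_separator G x y (K \<inter> L)" using KL x y by (simp add: clique_graph_parcs)
  then have sep: "(x, y) \<notin> (avoid (K \<inter> L))\<^sup>*" by (simp add: minimal_separator_def separator_iff)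
  define S where "S = K \<inter> L"
  assume "(K, L) \<in> {(X, Y) \<in> parcs (clique_graph G). \<not> X \<inter> Y \<subseteq> K \<inter> L}\<^sup>*"
  then have "(K, L) \<in> {(X, Y) \<in> parcs (clique_graph G). \<not> X \<inter> Y \<subseteq> S}\<^sup>*" by (simp add: S_def)
  then have "\<forall>u\<in>L - S. (x, u) \<in> (avoid S)\<^sup>*"
  proof (induction rule: rtrancl_induct)
    case base
    then show ?case using clique_avoid[OF maximal_cliqueD[OF max(1)] x(1)] x(2) by (auto simp: S_def)
  next
    case (step X Y)
    then obtain w where w: "w \<in> X" "w \<in> Y" "w \<notin> S" by blast
    have "is_clique G Y" using step.hyps by (auto simp: clique_graph_parcs maximal_cliqueD)
    then have "(w, u) \<in> (avoid (S))\<^sup>*" if "u \<in> Y - S" for u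
      using clique_avoid w(2,3) that by blast
    moreover have "(x, w) \<in> (avoid (S))\<^sup>*" using step.IH w by blast
    ultimately show ?case by (meson rtrancl_trans)
  qed
  then show False using sep y by (auto simp: S_def)
qed

text \<open>Two consecutive neighbours of \<open>s\<close> on the path would close an induced cycle.\<close>

lemma chordal_fan:
  assumes "chordal G"
    and path: "\<And>i. i < m \<Longrightarrow> (p i, p (Suc i)) \<in> parcs G"
    and dist: "\<And>i j. \<lbrakk>i < j; j \<le> m\<rbrakk> \<Longrightarrow> p i \<noteq> p j"
    and chordless: "\<And>i j. \<lbrakk>i < j; j \<le> m; (p i, p j) \<in> parcs G\<rbrakk> \<Longrightarrow> j = Suc i"
    and s: "\<And>i. i \<le> m \<Longrightarrow> p i \<noteq> s"
    and ends: "i \<le> j" "j \<le> m" "(s, p i) \<in> parcs G" "(s, p j) \<in> parcs G"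
    and "i \<le> k" "k \<le> j"
  shows "(s, p k) \<in> parcs G"
  using ends \<open>i \<le> k\<close> \<open>k \<le> j\<close>
proof (induction "j - i" arbitrary: i j rule: less_induct)
  case less
  show ?case
  proof (cases "\<exists>l. i < l \<and> l < j \<and> (s, p l) \<in> parcs G")
    case True
    then obtain l where l: "i < l" "l < j" "(s, p l) \<in> parcs G" by blast
    show ?thesis
    proof (cases "k \<le> l")
      case True
      then show ?thesis using less.hyps[of l i] less.prems l by auto
    next
      case False
      then show ?thesis using less.hyps[of j l] less.prems l by auto
    qed
  next
    case False
    show ?thesis
    proof (cases "j \<le> Suc i")
      case True
      then have "k = i \<or> k = j" using less.prems by linarith
      then show ?thesis using less.prems by blast
    next
      case long: False
      \<comment> \<open>The segment is closed through \<open>s\<close>. Chords are impossible: the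
        segment has none, and \<open>s\<close> is adjacent only to its ends.\<close>
      define q where "q = map (\<lambda>k. (p k, p (Suc k))) [i..<j]"
      define c where "c = (s, p i) # q @ [(p j, s)]"
      have verts: "pawalk_verts s c = s # map p [i..<Suc j] @ [s]"
        using awalk_verts_conv[of s c] less.prems(1) by (simp add: c_def q_def comp_def)
      have arcs_c: "set c = {(s, p i), (p j, s)} \<union> {(p k, p (Suc k)) | k. i \<le> k \<and> k < j}"
        by (auto simp: c_def q_def)
      have sub: "set c \<subseteq> parcs G"
        using path less.prems arcs_symmetric by (auto simp: arcs_c)
      have "awalk s c s"
        using sub less.prems(1,3) pcas_path_append[of i j p "[(p j, s)]" s]
        by (auto simp: awalk_def c_def q_def dest: in_arcsD1)
      moreover have "distinct (tl (pawalk_verts s c))"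
      proof -
        have "inj_on p {i..<Suc j}"
          by (rule linorder_inj_onI) (use dist less.prems in auto)
        moreover have "s \<notin> p ` {i..<Suc j}"
        proof
          assume "s \<in> p ` {i..<Suc j}"
          then obtain l where "s = p l" "l \<le> j" by auto
          then show False using s[of l] less.prems(2) by simp
        qed
        ultimately show ?thesis by (simp add: verts distinct_map del: upt_Suc)
      qed
      ultimately have "cycle c" by (auto simp: cycle_def c_def)
      moreover have "arcs (with_proj G \<restriction> (fst ` set c)) = set c \<union> (set c)\<inverse>"
      proof
        have ends_c: "fst ` set c = insert s (p ` {i..j})"
        proof -
          have "set (pawalk_verts s c) = fst ` set c \<union> {s}"
            using awalk_verts_conv[of s c] by (auto simp: c_def)
          moreover have "s \<in> fst ` set c" by (auto simp: c_def)
          ultimately show ?thesis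
            by (simp add: verts atLeastLessThanSuc_atLeastAtMost insert_absorb del: upt_Suc)
        qed
        show "set c \<union> (set c)\<inverse> \<subseteq> arcs (with_proj G \<restriction> (fst ` set c))"
          unfolding ends_c using sub less.prems arcs_symmetric by (auto simp: arcs_c)
        have sp: "l = i \<or> l = j" if "i \<le> l" "l \<le> j" "(s, p l) \<in> parcs G" for l
        proof (rule ccontr)
          assume "\<not> (l = i \<or> l = j)"
          then have "i < l" "l < j" using that by auto
          then show False using False that(3) by blast
        qed
        show "arcs (with_proj G \<restriction> (fst ` set c)) \<subseteq> set c \<union> (set c)\<inverse>"
        proof
          fix e assume e: "e \<in> arcs (with_proj G \<restriction> (fst ` set c))"
          obtain a b where ab: "e = (a, b)" by (cases e)
          have E: "(a, b) \<in> parcs G" "a \<in> insert s (p ` {i..j})" "b \<in> insert s (p ` {i..j})"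
            using e unfolding ends_c by (auto simp: ab)
          consider "a = s" "b = s" | l where "a = s" "b = p l" "i \<le> l" "l \<le> j"
            | l where "b = s" "a = p l" "i \<le> l" "l \<le> j"
            | k l where "a = p k" "b = p l" "i \<le> k" "k \<le> j" "i \<le> l" "l \<le> j"
            using E by auto
          then show "e \<in> set c \<union> (set c)\<inverse>"
          proof cases
            case 1
            then show ?thesis using E no_loops' by blast
          next
            case 2
            then show ?thesis using sp E by (auto simp: ab arcs_c)
          next
            case 3
            then show ?thesis using sp E arcs_symmetric by (auto simp: ab arcs_c)
          next
            case 4
            consider "k < l" | "k = l" | "l < k" by linarith
            then show ?thesis
            proof cases
              case 1
              then have "l = Suc k" using chordless[of k l] 4 E less.prems by auto
              then show ?thesis using 4 by (auto simp: ab arcs_c)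
            next
              case 2
              then have "(p k, p k) \<in> parcs G" using 4 E by simp
              then show ?thesis using no_loops' by blast
            next
              case 3
              then have "k = Suc l" using chordless[of l k] 4 E less.prems arcs_symmetric by auto
              then show ?thesis using 4 by (auto simp: ab arcs_c)
            qed
          qed
        qed
      qed
      \<comment> \<open>The segment has at least two arcs, and the two arcs at \<open>s\<close> come
        on top.\<close>
      moreover have "4 \<le> length c" using long by (simp add: c_def q_def)
      ultimately show ?thesis using assms(1) by (auto simp: chordal_def induced_cycle_def)
    qed
  qed
qed

text \<open>Any vertex of \<open>A \<inter> B\<close> links \<open>x\<close> in \<open>A\<close> to
  \<open>y\<close> in \<open>B\<close>, so no proper subset of \<open>A \<inter> B\<close> separates
  them. Failure of minimal separation is therefore failure of separation.\<close>

lemma non_edge_path: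
  assumes "maximal_clique G A" "maximal_clique G B" "A \<noteq> B" "(A, B) \<notin> parcs (clique_graph G)"
  obtains x y where "x \<in> A - B" "y \<in> B - A" "(x, y) \<in> (avoid (A \<inter> B))\<^sup>*"
proof -
  obtain x y where xy: "x \<in> A - B" "y \<in> B - A" "\<not> minimal_separator G x y (A \<inter> B)"
    using assms by (auto simp: clique_graph_parcs)
  have cl: "is_clique G A" "is_clique G B" using assms maximal_cliqueD by blast+
  have "\<not> separator G x y (A \<inter> B)"
  proof
    assume "separator G x y (A \<inter> B)"
    then obtain T where T: "T \<subset> A \<inter> B" "separator G x y T"
      using xy(3) by (auto simp: minimal_separator_def)
    then obtain s where s: "s \<in> A" "s \<in> B" "s \<notin> T" by blast
    have "(x, s) \<in> (avoid T)\<^sup>*" "(s, y) \<in> (avoid T)\<^sup>*"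
      using clique_avoid[OF cl(1), of x s T] clique_avoid[OF cl(2), of s y T] xy s T(1) by blast+
    then have "(x, y) \<in> (avoid T)\<^sup>*" by (rule rtrancl_trans)
    then show False using T(2) by (simp add: separator_iff)
  qed
  then have "(x, y) \<in> (avoid (A \<inter> B))\<^sup>*"
    using xy assms(1,2) maximal_clique_subset unfolding separator_iff by blast
  then show thesis using xy that by blast
qed

text \<open>If \<open>A\<close> and \<open>B\<close> are not adjacent, take a chordless path from
  \<open>A\<close> to \<open>B\<close> outside \<open>S = A \<inter> B\<close>. By chordality each
  of its vertices is adjacent to all of \<open>S\<close>, so \<open>S\<close> together with any edge
  of the path extends to a maximal clique. Successive cliques obtained in this way share more than
  \<open>S\<close> and are joined by induction, larger intersections coming first.\<close>

lemma clique_edge_or_path: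
  assumes "chordal G" "maximal_clique G A" "maximal_clique G B" "A \<noteq> B"
  shows "(A, B) \<in> parcs (clique_graph G) \<or>
    (A, B) \<in> {(X, Y) \<in> parcs (clique_graph G). A \<inter> B \<subset> X \<inter> Y}\<^sup>*"
  using assms(2-4)
proof (induction "card (pverts G) - card (A \<inter> B)" arbitrary: A B rule: less_induct)
  case less
  define S where "S = A \<inter> B"
  define R where "R = {(X, Y) \<in> parcs (clique_graph G). S \<subset> X \<inter> Y}"
  have cl: "is_clique G A" "is_clique G B" using less.prems maximal_cliqueD by blast+
  have join: "(X, Y) \<in> R\<^sup>*" if XY: "maximal_clique G X" "maximal_clique G Y" "S \<subset> X \<inter> Y" for X Y
  proof (cases "X = Y")
    case False
    have label: "X \<inter> Y \<subseteq> pverts G" using maximal_clique_subset[OF XY(1)] by blast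
    then have "finite (X \<inter> Y)" using pair_finite_verts finite_subset by blast
    then have "card S < card (X \<inter> Y)" using XY(3) by (rule psubset_card_mono)
    moreover have "card (X \<inter> Y) \<le> card (pverts G)" using label pair_finite_verts card_mono by blast
    ultimately have "card (pverts G) - card (X \<inter> Y) < card (pverts G) - card (A \<inter> B)"
      by (simp add: S_def)
    then consider "(X, Y) \<in> parcs (clique_graph G)"
      | "(X, Y) \<in> {(X', Y') \<in> parcs (clique_graph G). X \<inter> Y \<subset> X' \<inter> Y'}\<^sup>*"
      using less.hyps[OF _ XY(1,2) False] by blast
    then show ?thesis
    proof cases
      case 1
      then have "(X, Y) \<in> R" using XY by (simp add: R_def)
      then show ?thesis ..
    next
      case 2
      then show ?thesis by (rule rtrancl_subsetD) (use XY(3) in \<open>auto simp: R_def\<close>)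
    qed
  qed simp
  show ?case
  proof (cases "(A, B) \<in> parcs (clique_graph G)")
    case False
    obtain x y where xy: "x \<in> A - B" "y \<in> B - A" "(x, y) \<in> (avoid S)\<^sup>*"
      using non_edge_path[OF less.prems False] unfolding S_def .
    obtain p :: "nat \<Rightarrow> 'a" and m where p: "p 0 = x" "p m = y"
      "\<forall>i<m. (p i, p (Suc i)) \<in> avoid S"
      "\<forall>j\<le>m. \<forall>i<j. p i \<noteq> p j \<and> ((p i, p j) \<in> avoid S \<longrightarrow> j = Suc i)"
      using shortest_path[OF xy(3)] by blast
    have "0 < m" using p(1,2) xy by (cases m) auto
    \<comment> \<open>The last vertex is not the source of an arc of the path, hence the instance at
      \<open>i - 1\<close>.\<close>
    have pS: "p i \<in> pverts G - S" if "i \<le> m" for i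
      using that p(3)[rule_format, of i] p(3)[rule_format, of "i - 1"] \<open>0 < m\<close>
      by (cases "i < m") (auto simp: avoid_def)
    have adj: "(s, p k) \<in> parcs G" if s: "s \<in> S" and k: "k \<le> m" for s k
    proof (rule chordal_fan[OF assms(1), where p = p and i = 0 and j = m and m = m])
      show "(p i, p (Suc i)) \<in> parcs G" if "i < m" for i using p(3) that by (simp add: avoid_def)
      show "p i \<noteq> p j" if "i < j" "j \<le> m" for i j using p(4) that by blast
      show "j = Suc i" if "i < j" "j \<le> m" "(p i, p j) \<in> parcs G" for i j
        using p(4) pS[of i] pS[of j] that by (simp add: avoid_def)
      show "p i \<noteq> s" if "i \<le> m" for i using pS[OF that] s by auto
      show "(s, p 0) \<in> parcs G"
        using clique_adj[OF cl(1), of s x] s xy by (auto simp: p(1) S_def)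
      show "(s, p m) \<in> parcs G"
        using clique_adj[OF cl(2), of s y] s xy by (auto simp: p(2) S_def)
    qed (use k in auto)
    have "\<exists>W. maximal_clique G W \<and> S \<union> {p k, p (Suc k)} \<subseteq> W" if "k < m" for k
    proof -
      have k: "k \<le> m" "Suc k \<le> m" using that by auto
      have arc: "(p k, p (Suc k)) \<in> parcs G" using p(3) that by (simp add: avoid_def)
      have SA: "is_clique G S" using cl(1) by (auto simp: is_clique_iff S_def)
      have "is_clique G (S \<union> {p k, p (Suc k)})"
        unfolding is_clique_iff
      proof (intro conjI ballI impI)
        show "S \<union> {p k, p (Suc k)} \<subseteq> pverts G" using pS k SA by (auto simp: is_clique_iff)
        fix u v assume uv: "u \<in> S \<union> {p k, p (Suc k)}" "v \<in> S \<union> {p k, p (Suc k)}" "u \<noteq> v"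
        show "(u, v) \<in> parcs G"
          using uv clique_adj[OF SA, of u v] adj k arc arcs_symmetric by blast
      qed
      then show ?thesis using clique_extend by metis
    qed
    then obtain W where W: "\<And>k. k < m \<Longrightarrow> maximal_clique G (W k)"
        "\<And>k. k < m \<Longrightarrow> S \<union> {p k, p (Suc k)} \<subseteq> W k"
      by metis
    have reach: "(A, W k) \<in> R\<^sup>*" if "k < m" for k
      using that
    proof (induction k)
      case 0
      have "S \<subset> A \<inter> W 0" using W(2)[OF 0] xy(1) p(1) by (auto simp: S_def)
      then show ?case using join less.prems(1) W(1)[OF 0] by blast
    next
      case (Suc k)
      have "S \<subset> W k \<inter> W (Suc k)" using W(2)[of k] W(2)[of "Suc k"] pS[of "Suc k"] Suc.prems by auto
      then have "(W k, W (Suc k)) \<in> R\<^sup>*" using join W(1) Suc.prems by auto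
      then show ?case using Suc by (auto intro: rtrancl_trans)
    qed
    obtain l where l: "m = Suc l" using \<open>0 < m\<close> by (cases m) auto
    have "S \<subset> W l \<inter> B" using W(2)[of l] xy(2) p(2) l by (auto simp: S_def)
    then have "(W l, B) \<in> R\<^sup>*" using join W(1)[of l] l less.prems(2) by auto
    then have "(A, B) \<in> R\<^sup>*" using reach[of l] l by (auto intro: rtrancl_trans)
    then show ?thesis by (simp add: R_def S_def)
  qed simp
qed

section \<open>Simplicial vertices and maximal cliques\<close>

lemma simplicial_maximal_clique:
  assumes "simplicial G z"
  shows "maximal_clique G (closed_nbhd G z)"
  unfolding maximal_clique_def
proof (intro conjI allI impI)
  show "is_clique G (closed_nbhd G z)" using assms by (simp add: simplicial_def)
  fix L assume L: "is_clique G L \<and> closed_nbhd G z \<subseteq> L"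
  then have "z \<in> L" by (auto simp: closed_nbhd_def)
  then have "L \<subseteq> closed_nbhd G z" using L clique_adj[of L z] by (auto simp: closed_nbhd_def)
  then show "L = closed_nbhd G z" using L by blast
qed

text \<open>If the closed neighbourhood of \<open>v\<close> is a clique, it absorbs every maximal
  clique through \<open>v\<close>, so there is only one. Conversely, if \<open>Z\<close> is the only
  one, every edge at \<open>v\<close> extends to \<open>Z\<close>, so the neighbourhood is a
  clique.\<close>

lemma not_simplicial_iff:
  assumes Z: "maximal_clique G Z" and v: "v \<in> Z"
  shows "\<not> simplicial G v \<longleftrightarrow> (\<exists>X. maximal_clique G X \<and> X \<noteq> Z \<and> v \<in> X)"
proof
  assume "\<exists>X. maximal_clique G X \<and> X \<noteq> Z \<and> v \<in> X"
  then obtain X where X: "maximal_clique G X" "X \<noteq> Z" "v \<in> X" by blast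
  show "\<not> simplicial G v"
  proof
    assume "simplicial G v"
    then have "is_clique G (closed_nbhd G v)" by (simp add: simplicial_def)
    moreover have "X \<subseteq> closed_nbhd G v" "Z \<subseteq> closed_nbhd G v"
      using clique_adj[OF maximal_cliqueD[OF X(1)] X(3)] clique_adj[OF maximal_cliqueD[OF Z] v]
      by (auto simp: closed_nbhd_def)
    ultimately show False using maximal_clique_eqI X(1,2) Z by metis
  qed
next
  assume ns: "\<not> simplicial G v"
  show "\<exists>X. maximal_clique G X \<and> X \<noteq> Z \<and> v \<in> X"
  proof (rule ccontr)
    assume only: "\<nexists>X. maximal_clique G X \<and> X \<noteq> Z \<and> v \<in> X"
    have "closed_nbhd G v \<subseteq> Z"
    proof
      fix u assume u: "u \<in> closed_nbhd G v"
      show "u \<in> Z"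
      proof (cases "u = v")
        case False
        then have "(v, u) \<in> parcs G" using u by (simp add: closed_nbhd_def)
        then have "is_clique G {v, u}"
          by (auto simp: is_clique_iff arcs_symmetric dest: in_arcsD1 in_arcsD2)
        then obtain X where "maximal_clique G X" "{v, u} \<subseteq> X" using clique_extend by metis
        then show ?thesis using only by blast
      qed (use v in simp)
    qed
    then have "is_clique G (closed_nbhd G v)"
      using maximal_cliqueD[OF Z] by (auto simp: is_clique_iff)
    then show False using ns v maximal_clique_subset[OF Z] by (auto simp: simplicial_def)
  qed
qed

end

text \<open>Complete graphs are excluded because their clique graph is the single vertex N[z]: this
  alone forms a Prim ordering, but there is no edge for a critical sequence.\<close>

theorem theorem11:
  fixes G :: "'a pair_pre_digraph" and z :: 'a
  assumes "pair_graph G" and "connected G" and "chordal G"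
    and "\<not> is_clique G (pverts G)"
    and "simplicial G z"
  shows "((\<exists>Ks. prim_ordering (clique_graph G) Ks \<and> last Ks = closed_nbhd G z) \<longleftrightarrow>
            (\<exists>es. critical_sequence G z es)) \<and>
         (\<forall>es K. critical_sequence G z es \<longrightarrow>
            K \<in> pverts (clique_graph G) \<longrightarrow>
            K \<notin> verts (z_component G z (edge_label (hd es))) \<longrightarrow>
            (\<exists>Ks. prim_ordering (clique_graph G) Ks \<and> hd Ks = K \<and> last Ks = closed_nbhd G z))"
proof -
  interpret G: pair_graph G by fact
  define V where "V = {K. maximal_clique G K}"
  define E where "E = parcs (clique_graph G)"
  define Z where "Z = closed_nbhd G z"
  have CG: "clique_graph G = \<lparr>pverts = V, parcs = E\<rparr>"
    unfolding V_def E_def by (rule G.clique_graph_eq)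
  have Z_max: "maximal_clique G Z"
    unfolding Z_def using assms(5) by (rule G.simplicial_maximal_clique)
  interpret label_graph V E Z
  proof
    show "finite V"
      by (rule finite_subset[of _ "Pow (pverts G)"])
        (auto simp: V_def G.pair_finite_verts dest: G.maximal_clique_subset)
    show "finite A" if "A \<in> V" for A
      using that finite_subset[OF G.maximal_clique_subset[of A] G.pair_finite_verts]
      by (simp add: V_def)
    show "E \<subseteq> V \<times> V" by (auto simp: E_def V_def G.clique_graph_parcs)
    show "sym E" unfolding E_def by (rule G.sym_clique_graph)
    show "Z \<in> V" using Z_max by (simp add: V_def)
    show "(A, B) \<in> E \<or> (A, B) \<in> {(X, Y) \<in> E. A \<inter> B \<subset> X \<inter> Y}\<^sup>*"
      if "A \<in> V" "B \<in> V" "A \<noteq> B" for A B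
      using G.clique_edge_or_path[OF assms(3), of A B] that by (simp add: E_def V_def)
    show "(A, B) \<notin> {(X, Y) \<in> E. \<not> X \<inter> Y \<subseteq> A \<inter> B}\<^sup>*" if "(A, B) \<in> E" for A B
      using G.clique_edge_separates that by (simp add: E_def)
  qed
  have Q_not_Z: "Q 0 \<noteq> {Z}"
  proof
    assume "Q 0 = {Z}"
    then have only: "X = Z" if "maximal_clique G X" for X using that by (auto simp: Q_0 V_def)
    have "pverts G \<subseteq> Z"
    proof
      fix v assume "v \<in> pverts G"
      then have "is_clique G {v}" by (simp add: G.is_clique_iff)
      then obtain X where "maximal_clique G X" "{v} \<subseteq> X" using G.clique_extend by metis
      then show "v \<in> Z" using only by blast
    qed
    then have "pverts G = Z" using G.maximal_clique_subset[OF Z_max] by blast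
    then show False using assms(4) G.maximal_cliqueD[OF Z_max] by simp
  qed
  have top: "{v \<in> Z. \<not> simplicial G v} = Z \<inter> \<Union>(V - {Z})"
    using G.not_simplicial_iff[OF Z_max] by (auto simp: V_def)
  have prim_iff: "prim_ordering (clique_graph G) Ks \<longleftrightarrow> prim V Ks" for Ks
  proof -
    have "(\<exists>e\<in>cut_edges (clique_graph G) (set (take i Ks)). snd e = Ks ! i \<and>
           (\<forall>f\<in>cut_edges (clique_graph G) (set (take i Ks)). edge_weight f \<le> edge_weight e)) \<longleftrightarrow>
        (\<exists>A\<in>set (take i Ks). (A, Ks ! i) \<in> E \<and>
          (\<forall>X\<in>set (take i Ks). \<forall>Y\<in>V - set (take i Ks).
            (X, Y) \<in> E \<longrightarrow> card (X \<inter> Y) \<le> card (A \<inter> Ks ! i)))"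
      if "distinct Ks" "i < length Ks" for i
    proof -
      have "Ks ! i \<notin> set (take i Ks)" using in_set_take_iff[OF that] by simp
      then show ?thesis
        unfolding CG cut_edges_def edge_weight_def using E_subset by (fastforce simp: Bex_def)
    qed
    then show ?thesis unfolding prim_ordering_def prim_def by (auto simp: CG)
  qed
  have seq_iff: "critical_sequence G z es \<longleftrightarrow>
     es \<noteq> [] \<and>
     (\<exists>K p. pre_digraph.apath (with_proj \<lparr>pverts = V, parcs = E\<rparr>) K p Z \<and> subseq es p) \<and>
     edge_label ` critical_edges (with_proj \<lparr>pverts = V, parcs = E\<rparr>) Z = {edge_label (hd es)} \<and>
     edge_label (last es) = Z \<inter> \<Union>(V - {Z}) \<and>
     (\<forall>i. Suc i < length es \<longrightarrow>
        edge_label ` critical_edges (component (del_arcs (with_proj \<lparr>pverts = V, parcs = E\<rparr>)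
          {e. edge_label e \<subseteq> edge_label (es ! i)}) Z) Z = {edge_label (es ! Suc i)})" for es
    unfolding critical_sequence_def z_component_def CG Z_def[symmetric] top by simp
  have sequence: levels
    "\<And>K. K \<in> V \<Longrightarrow> K \<notin> verts (z_component G z (edge_label (hd es))) \<Longrightarrow> start 0 K"
    if "critical_sequence G z es" for es
  proof -
    have es: "es \<noteq> []" using that by (simp add: critical_sequence_def)
    let ?S = "\<lambda>i. edge_label (es ! i)" and ?k = "length es - 1"
    note cs = that[unfolded seq_iff]
    have hd: "edge_label ` critical_edges (with_proj \<lparr>pverts = V, parcs = E\<rparr>) Z = {?S 0}"
      using cs by (simp add: hd_conv_nth)
    have last: "?S ?k = Z \<inter> \<Union>(V - {Z})" 
    proof -
      have "edge_label (last es) = Z \<inter> \<Union>(V - {Z})" using cs by blast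
      then show ?thesis by (simp add: last_conv_nth[OF es])
    qed
    have step: "edge_label ` critical_edges (component (del_arcs (with_proj \<lparr>pverts = V, parcs = E\<rparr>)
          {e. edge_label e \<subseteq> ?S i}) Z) Z = {?S (Suc i)}" if "i < ?k" for i
      using cs that by simp
    show levels by (rule critical_levels(1)[where S = ?S and k = ?k, OF hd last step])
    show "start 0 K" if "K \<in> V" "K \<notin> verts (z_component G z (edge_label (hd es)))" for K
      using critical_levels(2)[where S = ?S and k = ?k, OF hd last step, of K] that es
      by (simp add: z_component_def CG Z_def hd_conv_nth)
  qed
  have to_seq: "\<exists>es. critical_sequence G z es" if "prim V Ks" "last Ks = Z" for Ks
  proof -
    have levels using that by (rule prim_levels)
    moreover obtain K where "start 0 K" by (rule start_exists)
    ultimately obtain p es where p: "pre_digraph.apath (with_proj \<lparr>pverts = V, parcs = E\<rparr>) K p Z"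
        "subseq es p" and es: "chain 0 es"
      using levels_chain by blast
    \<comment> \<open>The chain could be empty only if \<open>Z\<close> were the sole maximal
      clique.\<close>
    have ne: "es \<noteq> []" using es Q_not_Z by (auto elim: chain.cases)
    have "critical_sequence G z es"
      unfolding seq_iff
      using ne p chain_hd[OF es ne] chain_last[OF es ne] chain_nth[OF es] clique_digraph_Q by auto
    then show ?thesis ..
  qed
  have from_start: "\<exists>Ks. prim V Ks \<and> hd Ks = K \<and> last Ks = Z" if levels "start 0 K" for K
    using levels_prim[OF that] Q_0 by metis
  have "\<exists>Ks. prim V Ks \<and> last Ks = Z" if "critical_sequence G z es" for es
  proof -
    obtain K where "start 0 K" by (rule start_exists)
    then show ?thesis using from_start sequence(1)[OF that] by blast
  qed
  then show ?thesis
    unfolding prim_iff Z_def[symmetric]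
    using to_seq from_start sequence by (auto simp: CG)
qed

end
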